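(* Let $X_1,X_2,\dots$ be i.i.d. real-valued continuous random variables with $X_1\in L^{0+}$. For $p\in[-1,0)$ and $\alpha\in\overline{\mathbb{H}}$ let $f(x)=(x+\alpha)^p$ and $M^f_n=f^{-1}\left(\frac1n\sum_{j=1}^n f(X_j)\right)=\left(\frac1n\sum_{j=1}^n (X_j+\alpha)^p\right)^{1/p}-\alpha$. (i) Assume that either (a) $p\in[-1,0)$ and $\alpha\in\mathbb{H}$, or (b) $p\in(-1,0)$, $\alpha\in\mathbb{R}$ and $f(X_1)\in L^2$ holds. Then $$\lim_{n\to\infty} n\,\mathrm{Var}\left(M^f_n\right)=\frac{\mathrm{Var}(f(X_1))}{\left|f'\left(f^{-1}(E[f(X_1)])\right)\right|^2}.$$ (ii) If $p\in(-1,0)$, $\alpha\in\mathbb{R}$, $f(X_1)\in L^1$ and $f(X_1)\notin L^2$, then $$\lim_{n\to\infty} n\,\mathrm{Var}\left(M^f_n\right)=+\infty.$$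
   Context: $\mathbb{H}=\{z\in\mathbb{C}:\mathrm{Im}(z)>0\}$ and $\overline{\mathbb{H}}=\{z\in\mathbb{C}:\mathrm{Im}(z)\ge0\}$. Complex powers use the principal branch: $z^q=\exp(q\log z)$ with $\log z=\log r+i\theta$ for $z=r e^{i\theta}$, $r>0$, $\theta\in(-\pi,\pi]$. $f$ is regarded as an injective holomorphic function on a neighbourhood of $\overline{\mathbb{H}}\setminus\{-\alpha\}$, with $f^{-1}(w)=w^{1/p}-\alpha$ and $f'(z)=p(z+\alpha)^{p-1}$. For $s>0$, $Y\in L^s$ means $E[|Y|^s]<+\infty$; $Y\in L^{0+}$ means $Y\in L^s$ for some $s>0$. For complex-valued $Y$, $E[Y]=E[\mathrm{Re}(Y)]+iE[\mathrm{Im}(Y)]$ and $\mathrm{Var}(Y)=E[|Y-E[Y]|^2]$. "Continuous" random variable means that its distribution function is continuous, i.e. $P(X_1=x)=0$ for every $x\in\mathbb{R}$. *)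

theory Defs
  imports "HOL-Probability.Probability"
begin

(* Y \<in> L^s, for s > 0 *)
definition in_Ls :: "'a measure \<Rightarrow> real \<Rightarrow> ('a \<Rightarrow> 'b::real_normed_vector) \<Rightarrow> bool" where
  "in_Ls M s Y \<longleftrightarrow> Y \<in> borel_measurable M \<and> integrable M (\<lambda>\<omega>. norm (Y \<omega>) powr s)"

definition in_L0plus :: "'a measure \<Rightarrow> ('a \<Rightarrow> 'b::real_normed_vector) \<Rightarrow> bool" where
  "in_L0plus M Y \<longleftrightarrow> (\<exists>s>0. in_Ls M s Y)"

(* Real-valued, hence 0 when the integrand is not integrable.  On a probability space the
   value can be nonzero only if Y is in L^2 or Y is not measurable.  So for measurable Y_n, a
   limit of n * cvariance M Y_n that is positive or +infinity entails Y_n in L^2 for all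
   large n. *)
definition cvariance :: "'a measure \<Rightarrow> ('a \<Rightarrow> complex) \<Rightarrow> real" where
  "cvariance M Y = (\<integral>\<omega>. (cmod (Y \<omega> - (\<integral>\<omega>'. Y \<omega>' \<partial>M)))\<^sup>2 \<partial>M)"

(* Complex powr is the principal branch (Im (Ln z) in (-pi, pi]), with 0 powr q = 0; the
   value at z = -\<alpha> plays no role for random variables without atoms. *)
definition pow_gen :: "real \<Rightarrow> complex \<Rightarrow> complex \<Rightarrow> complex" where
  "pow_gen p \<alpha> z = (z + \<alpha>) powr complex_of_real p"

definition pow_gen_inv :: "real \<Rightarrow> complex \<Rightarrow> complex \<Rightarrow> complex" where
  "pow_gen_inv p \<alpha> w = w powr complex_of_real (1 / p) - \<alpha>"

(* The derivative of the holomorphic extension of pow_gen p \<alpha> to a neighbourhood of the closed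
   upper half-plane minus {-\<alpha>}.  It is given by its formula rather than by deriv, because for
   real \<alpha> the principal branch is discontinuous at the real points z < -\<alpha>, where deriv
   would be meaningless; on the closed half-plane the formula agrees with the extension. *)
definition pow_gen_deriv :: "real \<Rightarrow> complex \<Rightarrow> complex \<Rightarrow> complex" where
  "pow_gen_deriv p \<alpha> z = complex_of_real p * (z + \<alpha>) powr complex_of_real (p - 1)"

definition pow_mean :: "real \<Rightarrow> complex \<Rightarrow> (nat \<Rightarrow> 'a \<Rightarrow> real) \<Rightarrow> nat \<Rightarrow> 'a \<Rightarrow> complex" where
  "pow_mean p \<alpha> X n \<omega> =
     pow_gen_inv p \<alpha> ((\<Sum>j=1..n. pow_gen p \<alpha> (complex_of_real (X j \<omega>))) / of_nat n)"

end

theory Submission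
  imports Defs "HOL-Complex_Analysis.Cauchy_Integral_Theorem"
begin

text \<open>
  Write $Y_j = f(X_j)$, $S_n$ for their mean, $\mu = E[Y_1]$, and $g(w) = w^{1/p}$, so that
  $M_n^f = g(S_n) - \alpha$. The limit in (i) is the one that the delta method predicts, namely
  $|g'(\mu)|^2$ times the variance of $Y_1$, and two obstacles have to be removed. The function $g$
  has a pole at $0$, so that $g(S_n)$ might be large on a rare event, and $Y_1$ is only square
  integrable, so that the rare event on which $S_n$ is far from $\mu$ must be weighed against
  $|S_n - \mu|^2$.

  The pole is harmless because all values of $f$ lie in one half-plane. There are a unimodular
  $u$ and a power $a > 0$ with
  $\mathrm{Re}(u Y_j) \ge \kappa |X_j + \alpha|^{-a} > 0$ almost surely
  (\<open>pow_gen_in_half_plane\<close>). Hence $|S_n|$ is at least the arithmetic mean of the positive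
  variables $W_j = \mathrm{Re}(u Y_j)$, hence at least their geometric mean. Independence turns
  this into $E[|S_n|^{-nr}] \le E[W_1^{-r}]^n$ (\<open>sample_mean_negative_moment\<close>), where the
  right-hand side is finite for some $r > 0$ since $X_1 \in L^{0+}$. The exponent $nr$ grows with
  $n$, and so, as in a Chernoff bound, the contribution of $|S_n| \le c$ to any fixed negative moment
  decays exponentially once $c$ is small enough (\<open>mean_small_modulus_negligible\<close>). The event
  that $S_n$ is far from $\mu$ is controlled by splitting $Y_j$ into a bounded part, to which
  Hoeffding's inequality applies, and a part of small second moment (\<open>sq_tail_limit\<close>). Together
  they show that the remainder of the linearisation of $g$ at $\mu$ is $o(1/n)$ in squared
  $L^2$ norm, which is (i) (\<open>delta_method_cvariance\<close>).

  For (ii), near $\mu$ the map $g$ shrinks distances at most by a constant factor, so that the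
  variance of $g(S_n)$ is at least a constant times the spread of $S_n$ on the event
  $|S_n - \mu| \le \delta$, whose probability tends to $1$ by the weak law of large numbers. The
  spread is bounded below through characteristic functions: $1 - \cos x \le x^2/2$ gives, for
  every centre $d$ and every $t \neq 0$,
  $\frac{t^2}{2}\, n\, E[(\overline{W}_n - d)^2] \ge 1 - |\varphi_W(t/\sqrt n)|^n$,
  where $\overline{W}_n$ is the mean of the $W_j$. Restricting the expectation to the
  event changes the right-hand side only by $o(1)$. If $W_1$ has infinite second moment, then
  $(1 - |\varphi_W(h)|^2)/h^2 \to \infty$ as $h \to 0$, so the right-hand side tends to $1$; now
  let $t \to 0$ (\<open>infinite_variance_delta_method\<close>).
\<close>

section \<open>Means of independent, identically distributed random variables\<close>

(* Index ranges start at 1; rewriting 1 to Suc 0 would keep them from matching the facts below. *)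
declare One_nat_def [simp del]

definition sample_mean :: "(nat \<Rightarrow> 'a \<Rightarrow> 'b::real_normed_field) \<Rightarrow> nat \<Rightarrow> 'a \<Rightarrow> 'b" where
  "sample_mean Y n \<omega> = (\<Sum>j=1..n. Y j \<omega>) / of_nat n"

locale iid_sequence = prob_space M for M :: "'a measure" +
  fixes Y :: "nat \<Rightarrow> 'a \<Rightarrow> 'b::{real_normed_field, banach, second_countable_topology}"
  assumes indep: "indep_vars (\<lambda>_. borel) Y {1..}"
    and ident: "j \<ge> 1 \<Longrightarrow> distr M borel (Y j) = distr M borel (Y 1)"
begin

lemma measurable_term [measurable]: "j \<ge> 1 \<Longrightarrow> Y j \<in> borel_measurable M"
  using indep unfolding indep_vars_def by auto

lemma integral_term:
  fixes h :: "'b \<Rightarrow> 'c::{banach, second_countable_topology}"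
  assumes "j \<ge> 1" and [measurable]: "h \<in> borel_measurable borel"
  shows "(\<integral>\<omega>. h (Y j \<omega>) \<partial>M) = (\<integral>\<omega>. h (Y 1 \<omega>) \<partial>M)"
  using assms(1) ident[of j] integral_distr[of "Y j" M borel h] integral_distr[of "Y 1" M borel h]
  by simp

lemma integrable_term:
  fixes h :: "'b \<Rightarrow> 'c::{banach, second_countable_topology}"
  assumes "j \<ge> 1" and [measurable]: "h \<in> borel_measurable borel"
    and "integrable M (\<lambda>\<omega>. h (Y 1 \<omega>))"
  shows "integrable M (\<lambda>\<omega>. h (Y j \<omega>))"
  using assms ident[of j] integrable_distr_eq[of "Y j" M borel h]
    integrable_distr_eq[of "Y 1" M borel h]
  by simp

lemma AE_term:
  assumes "j \<ge> 1" and [measurable]: "Measurable.pred borel P"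
    and "AE \<omega> in M. P (Y 1 \<omega>)"
  shows "AE \<omega> in M. P (Y j \<omega>)"
proof -
  have "AE y in distr M borel (Y j). P y"
    unfolding ident[OF assms(1)] using assms(3) by (subst AE_distr_iff) auto
  then show ?thesis
    using assms(1) by (simp add: AE_distr_iff)
qed

lemma iid_compose:
  fixes h :: "'b \<Rightarrow> 'c::{real_normed_field, banach, second_countable_topology}"
  assumes [measurable]: "h \<in> borel_measurable borel"
  shows "iid_sequence M (\<lambda>j \<omega>. h (Y j \<omega>))"
proof
  show "indep_vars (\<lambda>_. borel) (\<lambda>j \<omega>. h (Y j \<omega>)) {1..}"
    by (rule indep_vars_compose2[OF indep]) auto
  fix j :: nat assume j: "j \<ge> 1"
  have "distr M borel (\<lambda>\<omega>. h (Y j \<omega>)) = distr (distr M borel (Y j)) borel h"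
    using j by (subst distr_distr) (auto simp: comp_def)
  also have "\<dots> = distr (distr M borel (Y 1)) borel h"
    by (simp only: ident[OF j])
  also have "\<dots> = distr M borel (\<lambda>\<omega>. h (Y 1 \<omega>))"
    by (subst distr_distr) (auto simp: comp_def)
  finally show "distr M borel (\<lambda>\<omega>. h (Y j \<omega>)) = distr M borel (\<lambda>\<omega>. h (Y 1 \<omega>))" .
qed

lemma measurable_sample_mean [measurable]: "sample_mean Y n \<in> borel_measurable M"
  unfolding sample_mean_def by measurable

lemma integrable_sample_mean:
  assumes "integrable M (Y 1)"
  shows "integrable M (sample_mean Y n)"
  unfolding sample_mean_def
  by (intro integrable_divide Bochner_Integration.integrable_sum)
    (use integrable_term[of _ "\<lambda>x. x"] assms in auto)

lemma expectation_sample_mean: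
  assumes "integrable M (Y 1)" "n \<ge> 1"
  shows "expectation (sample_mean Y n) = expectation (Y 1)"
proof -
  have "expectation (sample_mean Y n) = (\<Sum>j=1..n. expectation (Y j)) / of_nat n"
    unfolding sample_mean_def
    using integrable_term[of _ "\<lambda>x. x"] assms(1)
    by (simp add: Bochner_Integration.integral_sum)
  also have "(\<Sum>j=1..n. expectation (Y j)) = (\<Sum>j=1..n. expectation (Y 1))"
    by (intro sum.cong refl integral_term[of _ "\<lambda>x. x"]) simp_all
  finally show ?thesis using assms(2) by simp
qed

end

locale real_iid_sequence = iid_sequence M Y for M :: "'a measure" and Y :: "nat \<Rightarrow> 'a \<Rightarrow> real"
begin

lemma real_iid_compose:
  fixes h :: "real \<Rightarrow> real"
  assumes "h \<in> borel_measurable borel"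
  shows "real_iid_sequence M (\<lambda>j \<omega>. h (Y j \<omega>))"
  using iid_compose[OF assms] by (simp add: real_iid_sequence_def)

lemma indep_partial_sum:
  "indep_var borel (Y (Suc n)) borel (\<lambda>\<omega>. \<Sum>j=1..n. Y j \<omega>)"
proof -
  have "indep_vars (\<lambda>_. borel) Y (insert (Suc n) {1..n})"
    by (rule indep_vars_subset[OF indep]) auto
  then show ?thesis
    by (intro indep_vars_sum) auto
qed

lemma centered_sum_second_moment:
  assumes sq: "integrable M (\<lambda>\<omega>. (Y 1 \<omega>)\<^sup>2)" and zero: "expectation (Y 1) = 0"
  shows "integrable M (\<lambda>\<omega>. (\<Sum>j=1..n. Y j \<omega>)\<^sup>2)"
    and "expectation (\<lambda>\<omega>. (\<Sum>j=1..n. Y j \<omega>)\<^sup>2) = real n * expectation (\<lambda>\<omega>. (Y 1 \<omega>)\<^sup>2)"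
proof (induction n)
  case (Suc n)
  let ?S = "\<lambda>\<omega>. \<Sum>j=1..n. Y j \<omega>"
  have sqj: "integrable M (\<lambda>\<omega>. (Y (Suc n) \<omega>)\<^sup>2)"
    using integrable_term[of "Suc n" "\<lambda>x. x\<^sup>2"] sq by auto
  have int1: "integrable M (Y j)" if "j \<ge> 1" for j
    using integrable_term[of j "\<lambda>x. x\<^sup>2"] sq that square_integrable_imp_integrable[of "Y j"] by auto
  have intS: "integrable M ?S"
    using int1 by auto
  have intp: "integrable M (\<lambda>\<omega>. Y (Suc n) \<omega> * ?S \<omega>)"
    by (rule indep_var_integrable[OF indep_partial_sum int1 intS]) simp
  have "expectation (\<lambda>\<omega>. Y (Suc n) \<omega> * ?S \<omega>) = expectation (Y (Suc n)) * expectation ?S"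
    by (rule indep_var_lebesgue_integral[OF indep_partial_sum int1 intS]) simp
  also have "\<dots> = 0"
    using integral_term[of "Suc n" "\<lambda>x. x"] zero by simp
  finally have zp: "expectation (\<lambda>\<omega>. Y (Suc n) \<omega> * ?S \<omega>) = 0" .
  have eq: "(\<Sum>j=1..Suc n. Y j \<omega>)\<^sup>2 = (?S \<omega>)\<^sup>2 + 2 * (Y (Suc n) \<omega> * ?S \<omega>) + (Y (Suc n) \<omega>)\<^sup>2" for \<omega>
    by (simp add: power2_eq_square algebra_simps)
  show "integrable M (\<lambda>\<omega>. (\<Sum>j=1..Suc n. Y j \<omega>)\<^sup>2)"
    unfolding eq using Suc.IH(1) intp sqj by auto
  have "expectation (\<lambda>\<omega>. (\<Sum>j=1..Suc n. Y j \<omega>)\<^sup>2) =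
      expectation (\<lambda>\<omega>. (?S \<omega>)\<^sup>2) + expectation (\<lambda>\<omega>. (Y (Suc n) \<omega>)\<^sup>2)"
    unfolding eq using Suc.IH(1) intp sqj zp by simp
  also have "\<dots> = real (Suc n) * expectation (\<lambda>\<omega>. (Y 1 \<omega>)\<^sup>2)"
    using Suc.IH(2) integral_term[of "Suc n" "\<lambda>x. x\<^sup>2"] by (simp add: algebra_simps)
  finally show "expectation (\<lambda>\<omega>. (\<Sum>j=1..Suc n. Y j \<omega>)\<^sup>2) =
      real (Suc n) * expectation (\<lambda>\<omega>. (Y 1 \<omega>)\<^sup>2)" .
qed simp_all

lemma sample_mean_diff_const:
  fixes m :: real
  assumes "n \<ge> 1"
  shows "sample_mean (\<lambda>j \<omega>. Y j \<omega> - m) n \<omega> = sample_mean Y n \<omega> - m"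
  using assms by (simp add: sample_mean_def sum_subtractf diff_divide_distrib)

lemma sample_mean_variance:
  assumes sq: "integrable M (\<lambda>\<omega>. (Y 1 \<omega>)\<^sup>2)" and n: "n \<ge> 1"
  shows "integrable M (\<lambda>\<omega>. (sample_mean Y n \<omega> - expectation (Y 1))\<^sup>2)"
    and "real n * expectation (\<lambda>\<omega>. (sample_mean Y n \<omega> - expectation (Y 1))\<^sup>2) = variance (Y 1)"
proof -
  define m where "m = expectation (Y 1)"
  interpret C: real_iid_sequence M "\<lambda>j \<omega>. Y j \<omega> - m"
    by (rule real_iid_compose) simp
  have i1: "integrable M (Y 1)"
    using square_integrable_imp_integrable[OF _ sq] by simp
  have sqC: "integrable M (\<lambda>\<omega>. (Y 1 \<omega> - m)\<^sup>2)"
    using sq i1 by (simp add: power2_diff)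
  have "expectation (\<lambda>\<omega>. Y 1 \<omega> - m) = 0"
    using i1 by (simp add: m_def prob_space)
  note C = C.centered_sum_second_moment[OF sqC this, of n]
  have eq: "(sample_mean Y n \<omega> - m)\<^sup>2 = (\<Sum>j=1..n. Y j \<omega> - m)\<^sup>2 / (real n)\<^sup>2" for \<omega>
    unfolding sample_mean_diff_const[OF n, of m \<omega>, symmetric]
    by (simp add: sample_mean_def power_divide)
  show "integrable M (\<lambda>\<omega>. (sample_mean Y n \<omega> - expectation (Y 1))\<^sup>2)"
    unfolding m_def[symmetric] eq using C(1) by auto
  show "real n * expectation (\<lambda>\<omega>. (sample_mean Y n \<omega> - expectation (Y 1))\<^sup>2) = variance (Y 1)"
    unfolding m_def[symmetric] eq using C(2) n by (simp add: power2_eq_square)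
qed

text \<open>
  Hoeffding's inequality makes these probabilities exponentially small; the factor $n$ is the one
  with which variances of means are scaled.
\<close>

lemma bounded_mean_deviation:
  assumes bd: "\<And>\<omega>. \<bar>Y 1 \<omega>\<bar> \<le> L" and L: "L > 0" and e: "e > 0"
  shows "(\<lambda>n. real n * prob {\<omega>\<in>space M. \<bar>sample_mean Y n \<omega> - expectation (Y 1)\<bar> \<ge> e})
    \<longlonglongrightarrow> 0"
proof (rule tendsto_sandwich[OF _ _ tendsto_const])
  define c where "c = 2 * e\<^sup>2 / (2 * L)\<^sup>2"
  have c: "c > 0" using L e by (simp add: c_def)
  show "\<forall>\<^sub>F n in sequentially. 0 \<le>
      real n * prob {\<omega>\<in>space M. \<bar>sample_mean Y n \<omega> - expectation (Y 1)\<bar> \<ge> e}"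
    by simp
  have "prob {\<omega>\<in>space M. \<bar>sample_mean Y n \<omega> - expectation (Y 1)\<bar> \<ge> e} \<le> 2 * exp (- c * real n)"
    if n: "n \<ge> 1" for n
  proof -
    interpret H: Hoeffding_ineq_iid M "{1..n}" Y "Y 1" "-L" L "expectation (Y 1)"
    proof unfold_locales
      show "indep_vars (\<lambda>_. borel) Y {1..n}"
        by (rule indep_vars_subset[OF indep]) auto
      show "AE x in M. Y 1 x \<in> {- L..L}"
        using bd by (auto simp: abs_le_iff minus_le_iff)
    qed (auto intro: ident)
    have "- 2 * real (card {1..n}) * e\<^sup>2 / (L - - L)\<^sup>2 = - c * real n"
      by (simp add: c_def)
    moreover have "{1..n} \<noteq> {}" "- L < L" "0 \<le> e"
      using n L e by auto
    ultimately show ?thesis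
      using H.Hoeffding_ineq_abs_ge'[of e] by (simp add: sample_mean_def del: H.expectation_X)
  qed
  then show "\<forall>\<^sub>F n in sequentially.
      real n * prob {\<omega>\<in>space M. \<bar>sample_mean Y n \<omega> - expectation (Y 1)\<bar> \<ge> e}
      \<le> real n * (2 * exp (- c * real n))"
    by (intro eventually_mono[OF eventually_ge_at_top[of 1]] mult_left_mono) auto
  have "((\<lambda>x. x * (2 * exp (- c * x))) \<longlongrightarrow> 0) at_top"
    using c by real_asymp
  then show "(\<lambda>n. real n * (2 * exp (- c * real n))) \<longlonglongrightarrow> 0"
    by (rule filterlim_compose[OF _ filterlim_real_sequentially])
qed

text \<open>
  Dominated convergence: the tails of an integrable function of a random variable are small.
\<close>

lemma truncated_expectation:
  assumes "integrable M (\<lambda>\<omega>. h (Y 1 \<omega>))" and [measurable]: "h \<in> borel_measurable borel"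
    and nn: "\<And>x. h x \<ge> (0::real)" and "e > 0"
  obtains L where "L > 0" "expectation (\<lambda>\<omega>. if \<bar>Y 1 \<omega>\<bar> \<le> L then 0 else h (Y 1 \<omega>)) < e"
proof -
  have "(\<lambda>k. expectation (\<lambda>\<omega>. if \<bar>Y 1 \<omega>\<bar> \<le> real k then 0 else h (Y 1 \<omega>))) \<longlonglongrightarrow> expectation (\<lambda>\<omega>. 0)"
  proof (rule integral_dominated_convergence[where w = "\<lambda>\<omega>. h (Y 1 \<omega>)"])
    show "AE \<omega> in M. (\<lambda>k. if \<bar>Y 1 \<omega>\<bar> \<le> real k then 0 else h (Y 1 \<omega>)) \<longlonglongrightarrow> 0"
    proof (intro AE_I2 tendsto_eventually)
      fix \<omega>
      show "\<forall>\<^sub>F k in sequentially. (if \<bar>Y 1 \<omega>\<bar> \<le> real k then 0 else h (Y 1 \<omega>)) = 0"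
        by (intro eventually_mono[OF eventually_ge_at_top[of "nat \<lceil>\<bar>Y 1 \<omega>\<bar>\<rceil>"]]) auto
    qed
  qed (use assms in auto)
  then have "\<forall>\<^sub>F k in sequentially. expectation (\<lambda>\<omega>. if \<bar>Y 1 \<omega>\<bar> \<le> real k then 0 else h (Y 1 \<omega>)) < e"
    using \<open>e > 0\<close> by (intro order_tendstoD(2)) auto
  then obtain N where N: "expectation (\<lambda>\<omega>. if \<bar>Y 1 \<omega>\<bar> \<le> real k then 0 else h (Y 1 \<omega>)) < e" if "k \<ge> N" for k
    by (auto simp: eventually_sequentially)
  show ?thesis
    using that[of "real (Suc N)"] N[of "Suc N"] by auto
qed

end

section \<open>Truncation, the weak law, and the quadratic tail of a mean\<close>

definition clip :: "real \<Rightarrow> real \<Rightarrow> real" where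
  "clip L x = (if \<bar>x\<bar> \<le> L then x else 0)"

definition excess :: "real \<Rightarrow> real \<Rightarrow> real" where
  "excess L x = (if \<bar>x\<bar> \<le> L then 0 else x)"

lemma measurable_clip_excess [measurable]:
  "clip L \<in> borel_measurable borel" "excess L \<in> borel_measurable borel"
  unfolding clip_def[abs_def] excess_def[abs_def] by measurable

lemma clip_plus_excess: "clip L x + excess L x = x"
  by (simp add: clip_def excess_def)

context real_iid_sequence
begin

lemma integrable_truncation:
  assumes i1: "integrable M (Y 1)"
  shows "integrable M (\<lambda>\<omega>. clip L (Y 1 \<omega>))" "integrable M (\<lambda>\<omega>. excess L (Y 1 \<omega>))"
  by (rule Bochner_Integration.integrable_bound[OF i1]; auto simp: clip_def excess_def)+

text \<open>
  Both summands are again centred means, of a bounded sequence and of a sequence whose moments are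
  as small as desired when $L$ is large. The two limit theorems below treat them separately.
\<close>

lemma centered_mean_truncation:
  assumes i1: "integrable M (Y 1)"
  shows "sample_mean Y n \<omega> - expectation (Y 1) =
    (sample_mean (\<lambda>j \<omega>. clip L (Y j \<omega>)) n \<omega> - expectation (\<lambda>\<omega>. clip L (Y 1 \<omega>))) +
    (sample_mean (\<lambda>j \<omega>. excess L (Y j \<omega>)) n \<omega> - expectation (\<lambda>\<omega>. excess L (Y 1 \<omega>)))"
proof -
  have "expectation (Y 1) = expectation (\<lambda>\<omega>. clip L (Y 1 \<omega>) + excess L (Y 1 \<omega>))"
    by (simp add: clip_plus_excess)
  also have "\<dots> = expectation (\<lambda>\<omega>. clip L (Y 1 \<omega>)) + expectation (\<lambda>\<omega>. excess L (Y 1 \<omega>))"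
    using integrable_truncation[OF i1] by simp
  finally show ?thesis
    by (simp add: sample_mean_def clip_plus_excess flip: add_divide_distrib sum.distrib)
qed

text \<open>
  Only a first moment is assumed, so Chebyshev's inequality is not available. The clipped part obeys
  Hoeffding's inequality; the excess has small $L^1$ norm, uniformly in $n$, and Markov's
  inequality applies.
\<close>

lemma weak_law:
  assumes i1: "integrable M (Y 1)" and \<delta>: "\<delta> > 0"
  shows "(\<lambda>n. prob {\<omega>\<in>space M. \<delta> \<le> \<bar>sample_mean Y n \<omega> - expectation (Y 1)\<bar>}) \<longlonglongrightarrow> 0"
proof (rule LIMSEQ_I)
  fix r :: real assume r: "r > 0"
  define e where "e = r * \<delta> / 8"
  have e: "e > 0" using r \<delta> by (simp add: e_def)
  obtain L where L: "L > 0"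
    and tail: "expectation (\<lambda>\<omega>. if \<bar>Y 1 \<omega>\<bar> \<le> L then 0 else \<bar>Y 1 \<omega>\<bar>) < e"
    using truncated_expectation[of abs e] i1 e by auto
  interpret S: real_iid_sequence M "\<lambda>j \<omega>. clip L (Y j \<omega>)" by (rule real_iid_compose) measurable
  interpret B: real_iid_sequence M "\<lambda>j \<omega>. excess L (Y j \<omega>)" by (rule real_iid_compose) measurable
  define TS where "TS n \<omega> = sample_mean (\<lambda>j \<omega>. clip L (Y j \<omega>)) n \<omega> - expectation (\<lambda>\<omega>. clip L (Y 1 \<omega>))" for n \<omega>
  define TB where "TB n \<omega> = sample_mean (\<lambda>j \<omega>. excess L (Y j \<omega>)) n \<omega> - expectation (\<lambda>\<omega>. excess L (Y 1 \<omega>))" for n \<omega>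
  have [measurable]: "TS n \<in> borel_measurable M" "TB n \<in> borel_measurable M" for n
    unfolding TS_def[abs_def] TB_def[abs_def] by measurable
  note iS = integrable_truncation(1)[OF i1, of L] and iB = integrable_truncation(2)[OF i1, of L]
  have T: "sample_mean Y n \<omega> - expectation (Y 1) = TS n \<omega> + TB n \<omega>" for n \<omega>
    unfolding TS_def TB_def by (rule centered_mean_truncation[OF i1])
  have absb: "\<bar>excess L x\<bar> = (if \<bar>x\<bar> \<le> L then 0 else \<bar>x\<bar>)" for x by (simp add: excess_def)
  have eB: "expectation (\<lambda>\<omega>. \<bar>excess L (Y 1 \<omega>)\<bar>) < e"
    using tail by (simp add: absb)
  have abs_B_mean: "expectation (\<lambda>\<omega>. \<bar>TB n \<omega>\<bar>) \<le> 2 * e"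
    and iTB: "integrable M (\<lambda>\<omega>. \<bar>TB n \<omega>\<bar>)" if n: "n \<ge> 1" for n
  proof -
    interpret BA: real_iid_sequence M "\<lambda>j \<omega>. \<bar>excess L (Y j \<omega>)\<bar>" by (rule real_iid_compose) measurable
    have iBA: "integrable M (sample_mean (\<lambda>j \<omega>. \<bar>excess L (Y j \<omega>)\<bar>) n)"
      by (rule BA.integrable_sample_mean) (use iB in auto)
    have le: "\<bar>TB n \<omega>\<bar> \<le> sample_mean (\<lambda>j \<omega>. \<bar>excess L (Y j \<omega>)\<bar>) n \<omega> + e" for \<omega>
    proof -
      have "\<bar>sample_mean (\<lambda>j \<omega>. excess L (Y j \<omega>)) n \<omega>\<bar> \<le> sample_mean (\<lambda>j \<omega>. \<bar>excess L (Y j \<omega>)\<bar>) n \<omega>"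
        unfolding sample_mean_def abs_divide by (auto intro!: divide_right_mono sum_abs)
      moreover have "\<bar>expectation (\<lambda>\<omega>. excess L (Y 1 \<omega>))\<bar> \<le> e"
        using integral_abs_bound[of M "\<lambda>\<omega>. excess L (Y 1 \<omega>)"] eB by linarith
      ultimately show ?thesis unfolding TB_def by linarith
    qed
    show iTB: "integrable M (\<lambda>\<omega>. \<bar>TB n \<omega>\<bar>)"
      unfolding TB_def using B.integrable_sample_mean[OF iB] by auto
    have "expectation (\<lambda>\<omega>. \<bar>TB n \<omega>\<bar>) \<le> expectation (\<lambda>\<omega>. sample_mean (\<lambda>j \<omega>. \<bar>excess L (Y j \<omega>)\<bar>) n \<omega> + e)"
      by (intro integral_mono iTB) (use iBA le in auto)
    also have "\<dots> = expectation (\<lambda>\<omega>. \<bar>excess L (Y 1 \<omega>)\<bar>) + e"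
      using BA.expectation_sample_mean[OF _ n] iBA iB by (simp add: prob_space)
    finally show "expectation (\<lambda>\<omega>. \<bar>TB n \<omega>\<bar>) \<le> 2 * e" using eB by simp
  qed
  have "(\<lambda>n. real n * prob {\<omega>\<in>space M. \<bar>TS n \<omega>\<bar> \<ge> \<delta>/2}) \<longlonglongrightarrow> 0"
    unfolding TS_def using L \<delta> by (intro S.bounded_mean_deviation[of L]) (auto simp: clip_def)
  from LIMSEQ_D[OF this, of "r/2"] r
  obtain N where N: "\<And>n. n \<ge> N \<Longrightarrow> real n * prob {\<omega>\<in>space M. \<bar>TS n \<omega>\<bar> \<ge> \<delta>/2} < r/2"
    by auto
  show "\<exists>no. \<forall>n\<ge>no. norm (prob {\<omega>\<in>space M. \<delta> \<le> \<bar>sample_mean Y n \<omega> - expectation (Y 1)\<bar>} - 0) < r"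
  proof (intro exI allI impI)
    fix n assume n: "n \<ge> max N 1"
    have "prob {\<omega>\<in>space M. \<delta> \<le> \<bar>TS n \<omega> + TB n \<omega>\<bar>}
        \<le> prob ({\<omega>\<in>space M. \<bar>TS n \<omega>\<bar> \<ge> \<delta>/2} \<union> {\<omega>\<in>space M. \<bar>TB n \<omega>\<bar> \<ge> \<delta>/2})"
      by (intro finite_measure_mono) auto
    also have "\<dots> \<le> prob {\<omega>\<in>space M. \<bar>TS n \<omega>\<bar> \<ge> \<delta>/2} + prob {\<omega>\<in>space M. \<bar>TB n \<omega>\<bar> \<ge> \<delta>/2}"
      by (intro measure_Un_le) auto
    also have "prob {\<omega>\<in>space M. \<bar>TS n \<omega>\<bar> \<ge> \<delta>/2} \<le> real n * prob {\<omega>\<in>space M. \<bar>TS n \<omega>\<bar> \<ge> \<delta>/2}"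
      using n mult_right_mono[of 1 "real n" "prob {\<omega>\<in>space M. \<bar>TS n \<omega>\<bar> \<ge> \<delta>/2}"] by simp
    also have "prob {\<omega>\<in>space M. \<bar>TB n \<omega>\<bar> \<ge> \<delta>/2} \<le> expectation (\<lambda>\<omega>. \<bar>TB n \<omega>\<bar>) / (\<delta>/2)"
      using integral_Markov_inequality_measure[of M "\<lambda>\<omega>. \<bar>TB n \<omega>\<bar>" "{}" "\<delta>/2"] iTB[of n] n \<delta> by simp
    also have "\<dots> \<le> 2 * e / (\<delta>/2)"
      using abs_B_mean[of n] n \<delta> by (intro divide_right_mono) auto
    also have "\<dots> = r / 2" using \<delta> by (simp add: e_def)
    finally show "norm (prob {\<omega>\<in>space M. \<delta> \<le> \<bar>sample_mean Y n \<omega> - expectation (Y 1)\<bar>} - 0) < r"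
      using N[of n] n by (simp add: T)
  qed
qed

text \<open>
  This says that the variables $n (S_n - \mu)^2$ put asymptotically no mass on the event
  $|S_n - \mu| > \delta$, although their expectation is constant in $n$. On that event the larger
  of the clipped part $T_S$ and the excess part $T_B$ of the deviation is at least $\delta/2$.
  If it is $T_B$, then $4 T_B^2$ bounds the square, and $n E[T_B^2]$ is the small variance of the
  excess. If it is $T_S$, the square is bounded and the event has exponentially small probability.
\<close>

lemma sq_tail_limit:
  assumes sq: "integrable M (\<lambda>\<omega>. (Y 1 \<omega>)\<^sup>2)" and \<delta>: "\<delta> > 0"
  shows "(\<lambda>n. real n * expectation (\<lambda>\<omega>. if \<bar>sample_mean Y n \<omega> - expectation (Y 1)\<bar> > \<delta>
      then (sample_mean Y n \<omega> - expectation (Y 1))\<^sup>2 else 0)) \<longlonglongrightarrow> 0"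
proof (rule LIMSEQ_I)
  fix r :: real assume r: "r > 0"
  define e where "e = r / 8"
  have e: "e > 0" using r by (simp add: e_def)
  have i1: "integrable M (Y 1)"
    using square_integrable_imp_integrable[OF _ sq] by simp
  obtain L where L: "L > 0"
    and tail: "expectation (\<lambda>\<omega>. if \<bar>Y 1 \<omega>\<bar> \<le> L then 0 else (Y 1 \<omega>)\<^sup>2) < e"
    using truncated_expectation[of "\<lambda>x. x\<^sup>2" e] sq e by auto
  interpret S: real_iid_sequence M "\<lambda>j \<omega>. clip L (Y j \<omega>)" by (rule real_iid_compose) measurable
  interpret B: real_iid_sequence M "\<lambda>j \<omega>. excess L (Y j \<omega>)" by (rule real_iid_compose) measurable
  define TS where "TS n \<omega> = sample_mean (\<lambda>j \<omega>. clip L (Y j \<omega>)) n \<omega> - expectation (\<lambda>\<omega>. clip L (Y 1 \<omega>))" for n \<omega>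
  define TB where "TB n \<omega> = sample_mean (\<lambda>j \<omega>. excess L (Y j \<omega>)) n \<omega> - expectation (\<lambda>\<omega>. excess L (Y 1 \<omega>))" for n \<omega>
  have [measurable]: "TS n \<in> borel_measurable M" "TB n \<in> borel_measurable M" for n
    unfolding TS_def[abs_def] TB_def[abs_def] by measurable
  note iS = integrable_truncation(1)[OF i1, of L] and iB = integrable_truncation(2)[OF i1, of L]
  have sqB: "integrable M (\<lambda>\<omega>. (excess L (Y 1 \<omega>))\<^sup>2)"
    by (rule Bochner_Integration.integrable_bound[OF sq]) (auto simp: excess_def)
  have T: "sample_mean Y n \<omega> - expectation (Y 1) = TS n \<omega> + TB n \<omega>" for n \<omega>
    unfolding TS_def TB_def by (rule centered_mean_truncation[OF i1])
  have sqb: "(excess L x)\<^sup>2 = (if \<bar>x\<bar> \<le> L then 0 else x\<^sup>2)" for x by (simp add: excess_def)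
  have "expectation (\<lambda>\<omega>. (excess L (Y 1 \<omega>))\<^sup>2) < e"
    using tail by (simp add: sqb)
  then have varB: "variance (\<lambda>\<omega>. excess L (Y 1 \<omega>)) < e"
    using variance_eq[OF iB sqB] by (smt (verit) zero_le_power2)
  have TSle: "\<bar>TS n \<omega>\<bar> \<le> 2 * L" for n \<omega>
  proof -
    have sm: "\<bar>clip L x\<bar> \<le> L" for x using L by (simp add: clip_def)
    have "\<bar>\<Sum>j=1..n. clip L (Y j \<omega>)\<bar> \<le> (\<Sum>j=1..n. L)"
      by (rule order_trans[OF sum_abs sum_mono]) (rule sm)
    then have "\<bar>sample_mean (\<lambda>j \<omega>. clip L (Y j \<omega>)) n \<omega>\<bar> \<le> L"
      using L by (cases "n = 0") (auto simp: sample_mean_def abs_divide divide_simps mult_ac)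
    moreover have "\<bar>expectation (\<lambda>\<omega>. clip L (Y 1 \<omega>))\<bar> \<le> expectation (\<lambda>\<omega>. L)"
      by (rule order_trans[OF integral_abs_bound integral_mono]) (use iS sm in auto)
    ultimately show ?thesis unfolding TS_def by (simp add: prob_space)
  qed
  define BS where "BS n = {\<omega>\<in>space M. \<bar>TS n \<omega>\<bar> \<ge> \<delta>/2}" for n
  have [measurable]: "BS n \<in> sets M" for n unfolding BS_def by measurable
  have pw: "(if \<bar>TS n \<omega> + TB n \<omega>\<bar> > \<delta> then (TS n \<omega> + TB n \<omega>)\<^sup>2 else 0)
      \<le> 4 * (TB n \<omega>)\<^sup>2 + 16 * L\<^sup>2 * indicator (BS n) \<omega>" if "\<omega> \<in> space M" for n \<omega>
  proof (cases "\<bar>TS n \<omega> + TB n \<omega>\<bar> > \<delta>")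
    case True
    show ?thesis
    proof (cases "\<bar>TS n \<omega>\<bar> \<le> \<bar>TB n \<omega>\<bar>")
      case le: True
      have "\<bar>TS n \<omega> + TB n \<omega>\<bar> \<le> 2 * \<bar>TB n \<omega>\<bar>" using le by linarith
      then have "(TS n \<omega> + TB n \<omega>)\<^sup>2 \<le> 4 * (TB n \<omega>)\<^sup>2"
        using power_mono[of "\<bar>TS n \<omega> + TB n \<omega>\<bar>" "2 * \<bar>TB n \<omega>\<bar>" 2] by (simp add: power_mult_distrib)
      moreover have "0 \<le> 16 * L\<^sup>2 * (indicator (BS n) \<omega> :: real)" by simp
      ultimately show ?thesis using True by (simp add: add_increasing2)
    next
      case False
      then have "\<omega> \<in> BS n" using True that by (auto simp: BS_def)
      have "\<bar>TS n \<omega> + TB n \<omega>\<bar> \<le> 4 * L" using False TSle[of n \<omega>] by linarith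
      then have "(TS n \<omega> + TB n \<omega>)\<^sup>2 \<le> 16 * L\<^sup>2"
        using power_mono[of "\<bar>TS n \<omega> + TB n \<omega>\<bar>" "4 * L" 2] by (simp add: power_mult_distrib)
      then show ?thesis using True \<open>\<omega> \<in> BS n\<close> by (simp add: add_increasing)
    qed
  qed simp
  have "(\<lambda>n. real n * prob (BS n)) \<longlonglongrightarrow> 0"
    unfolding BS_def TS_def using L \<delta> by (intro S.bounded_mean_deviation[of L]) (auto simp: clip_def)
  then have "(\<lambda>n. 16 * L\<^sup>2 * (real n * prob (BS n))) \<longlonglongrightarrow> 0"
    by (intro tendsto_mult_right_zero)
  from LIMSEQ_D[OF this, of "r/2"] r
  obtain N where N: "\<And>n. n \<ge> N \<Longrightarrow> 16 * L\<^sup>2 * (real n * prob (BS n)) < r/2"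
    by fastforce
  show "\<exists>no. \<forall>n\<ge>no. norm (real n * expectation (\<lambda>\<omega>. if \<bar>sample_mean Y n \<omega> - expectation (Y 1)\<bar> > \<delta>
      then (sample_mean Y n \<omega> - expectation (Y 1))\<^sup>2 else 0) - 0) < r"
  proof (intro exI allI impI)
    fix n assume n: "n \<ge> max N 1"
    define E where "E = expectation (\<lambda>\<omega>. if \<bar>TS n \<omega> + TB n \<omega>\<bar> > \<delta> then (TS n \<omega> + TB n \<omega>)\<^sup>2 else 0)"
    have iB2: "integrable M (\<lambda>\<omega>. (TB n \<omega>)\<^sup>2)"
      and eB2: "real n * expectation (\<lambda>\<omega>. (TB n \<omega>)\<^sup>2) = variance (\<lambda>\<omega>. excess L (Y 1 \<omega>))"
      using B.sample_mean_variance[OF sqB, of n] n by (simp_all add: TB_def)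
    have "E \<le> expectation (\<lambda>\<omega>. 4 * (TB n \<omega>)\<^sup>2 + 16 * L\<^sup>2 * indicator (BS n) \<omega>)"
      unfolding E_def by (intro integral_mono_AE' AE_I2 pw) (use iB2 in \<open>auto simp: less_top[symmetric]\<close>)
    also have "\<dots> = 4 * expectation (\<lambda>\<omega>. (TB n \<omega>)\<^sup>2) + 16 * L\<^sup>2 * prob (BS n)"
      using iB2 by (simp add: less_top[symmetric])
    finally have "real n * E \<le> real n * (4 * expectation (\<lambda>\<omega>. (TB n \<omega>)\<^sup>2) + 16 * L\<^sup>2 * prob (BS n))"
      by (rule mult_left_mono) simp
    also have "\<dots> = 4 * variance (\<lambda>\<omega>. excess L (Y 1 \<omega>)) + 16 * L\<^sup>2 * (real n * prob (BS n))"
      unfolding eB2[symmetric] by (simp add: algebra_simps)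
    also have "\<dots> < 4 * e + r / 2"
      using N[of n] n varB by auto
    also have "\<dots> = r" by (simp add: e_def)
    finally have "real n * E < r" .
    moreover have "0 \<le> E" unfolding E_def by (rule Bochner_Integration.integral_nonneg) simp
    ultimately show "norm (real n * expectation (\<lambda>\<omega>. if \<bar>sample_mean Y n \<omega> - expectation (Y 1)\<bar> > \<delta>
      then (sample_mean Y n \<omega> - expectation (Y 1))\<^sup>2 else 0) - 0) < r"
      unfolding T E_def[symmetric] by simp
  qed
qed

end

section \<open>Negative moments and complex means\<close>

context real_iid_sequence
begin

lemma AE_all_terms:
  assumes "Measurable.pred borel P" "AE \<omega> in M. P (Y 1 \<omega>)"
  shows "AE \<omega> in M. \<forall>j\<in>{1..n}. P (Y j \<omega>)"
  using AE_term[OF _ assms] by (intro AE_finite_allI) auto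

text \<open>
  By the inequality of arithmetic and geometric means,
  $S_n^{-nr} \le \prod_j Y_j^{-r}$, and the expectation of the product factorises. Choosing an
  exponent proportional to $n$ is what makes the factors integrable for an arbitrarily small $r$.
\<close>

lemma sample_mean_negative_moment:
  assumes pos: "AE \<omega> in M. Y 1 \<omega> > 0" and r: "r > 0"
    and int: "integrable M (\<lambda>\<omega>. Y 1 \<omega> powr (- r))" and n: "n \<ge> 1"
  shows "AE \<omega> in M. sample_mean Y n \<omega> > 0"
    and "integrable M (\<lambda>\<omega>. sample_mean Y n \<omega> powr (- (real n * r)))"
    and "expectation (\<lambda>\<omega>. sample_mean Y n \<omega> powr (- (real n * r)))
      \<le> expectation (\<lambda>\<omega>. Y 1 \<omega> powr (- r)) ^ n"
proof -
  have allpos: "AE \<omega> in M. \<forall>j\<in>{1..n}. Y j \<omega> > 0"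
    by (rule AE_all_terms[OF _ pos]) simp
  have amgm: "sample_mean Y n \<omega> > 0 \<and>
      sample_mean Y n \<omega> powr (- (real n * r)) \<le> (\<Prod>j\<in>{1..n}. Y j \<omega> powr (- r))"
    if p: "\<forall>j\<in>{1..n}. Y j \<omega> > 0" for \<omega>
  proof -
    have P: "(\<Prod>j\<in>{1..n}. Y j \<omega>) > 0" using p by (intro prod_pos) auto
    have ge: "(\<Prod>j\<in>{1..n}. Y j \<omega>) powr (1 / real n) \<le> sample_mean Y n \<omega>"
      using arith_geom_mean[of "{1..n}" "\<lambda>j. Y j \<omega>"] p n
      by (auto simp: sample_mean_def sum_divide_distrib less_imp_le)
    moreover have G: "(\<Prod>j\<in>{1..n}. Y j \<omega>) powr (1 / real n) > 0" using P by (metis powr_gt_zero less_irrefl)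
    ultimately have mpos: "sample_mean Y n \<omega> > 0" by linarith
    have "sample_mean Y n \<omega> powr (- (real n * r))
        \<le> ((\<Prod>j\<in>{1..n}. Y j \<omega>) powr (1 / real n)) powr (- (real n * r))"
      by (intro powr_mono2' G ge) (use r in simp)
    also have "\<dots> = (\<Prod>j\<in>{1..n}. Y j \<omega>) powr (- r)"
      using n by (simp add: powr_powr)
    also have "\<dots> = (\<Prod>j\<in>{1..n}. Y j \<omega> powr (- r))"
      by (rule prod_powr_distrib)
    finally show ?thesis using mpos by simp
  qed
  show "AE \<omega> in M. sample_mean Y n \<omega> > 0"
    using allpos by eventually_elim (use amgm in blast)
  have ind: "indep_vars (\<lambda>_. borel) (\<lambda>j \<omega>. Y j \<omega> powr (- r)) {1..n}"
    by (rule indep_vars_compose2[OF indep_vars_subset[OF indep]]) auto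
  have intj: "integrable M (\<lambda>\<omega>. Y j \<omega> powr (- r))" if "j \<ge> 1" for j
    using integrable_term[of j "\<lambda>x. x powr (- r)"] int that by simp
  have intP: "integrable M (\<lambda>\<omega>. \<Prod>j\<in>{1..n}. Y j \<omega> powr (- r))"
    by (rule indep_vars_integrable[OF _ ind]) (use intj in auto)
  have AEle: "AE \<omega> in M. sample_mean Y n \<omega> powr (- (real n * r)) \<le> (\<Prod>j\<in>{1..n}. Y j \<omega> powr (- r))"
    using allpos by eventually_elim (use amgm in blast)
  show intm: "integrable M (\<lambda>\<omega>. sample_mean Y n \<omega> powr (- (real n * r)))"
    by (rule Bochner_Integration.integrable_bound[OF intP])
      (use AEle in \<open>auto simp: prod_nonneg\<close>)
  have "expectation (\<lambda>\<omega>. sample_mean Y n \<omega> powr (- (real n * r)))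
      \<le> expectation (\<lambda>\<omega>. \<Prod>j\<in>{1..n}. Y j \<omega> powr (- r))"
    by (rule integral_mono_AE[OF intm intP AEle])
  also have "\<dots> = (\<Prod>j\<in>{1..n}. expectation (\<lambda>\<omega>. Y j \<omega> powr (- r)))"
    by (rule indep_vars_lebesgue_integral[OF _ ind]) (use intj in auto)
  also have "\<dots> = (\<Prod>j\<in>{1..n}. expectation (\<lambda>\<omega>. Y 1 \<omega> powr (- r)))"
    by (intro prod.cong refl integral_term[of _ "\<lambda>x. x powr (- r)"]) auto
  finally show "expectation (\<lambda>\<omega>. sample_mean Y n \<omega> powr (- (real n * r)))
      \<le> expectation (\<lambda>\<omega>. Y 1 \<omega> powr (- r)) ^ n" by simp
qed

end

locale complex_iid_sequence = iid_sequence M Y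
  for M :: "'a measure" and Y :: "nat \<Rightarrow> 'a \<Rightarrow> complex"
begin

lemma real_iid_image:
  fixes h :: "complex \<Rightarrow> real"
  assumes "h \<in> borel_measurable borel"
  shows "real_iid_sequence M (\<lambda>j \<omega>. h (Y j \<omega>))"
  using iid_compose[OF assms] by (simp add: real_iid_sequence_def)

sublocale Re: real_iid_sequence M "\<lambda>j \<omega>. Re (Y j \<omega>)"
  by (rule real_iid_image) simp

sublocale Im: real_iid_sequence M "\<lambda>j \<omega>. Im (Y j \<omega>)"
  by (rule real_iid_image) simp

lemma sample_mean_Re_mult:
  "sample_mean (\<lambda>j \<omega>. Re (u * Y j \<omega>)) n \<omega> = Re (u * sample_mean Y n \<omega>)"
proof -
  have "sample_mean (\<lambda>j \<omega>. Re (u * Y j \<omega>)) n \<omega> = Re ((\<Sum>j=1..n. u * Y j \<omega>) / of_nat n)"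
    by (simp only: sample_mean_def Re_divide_of_nat Re_sum)
  then show ?thesis
    by (simp only: sample_mean_def sum_distrib_left times_divide_eq_right)
qed

lemma Re_sample_mean: "Re (sample_mean Y n \<omega>) = sample_mean (\<lambda>j \<omega>. Re (Y j \<omega>)) n \<omega>"
  by (simp add: sample_mean_def)

lemma Im_sample_mean: "Im (sample_mean Y n \<omega>) = sample_mean (\<lambda>j \<omega>. Im (Y j \<omega>)) n \<omega>"
  by (simp add: sample_mean_def)

lemma cmod_centered_mean_sq:
  assumes "integrable M (Y 1)"
  shows "(cmod (sample_mean Y n \<omega> - expectation (Y 1)))\<^sup>2 =
    (sample_mean (\<lambda>j \<omega>. Re (Y j \<omega>)) n \<omega> - expectation (\<lambda>\<omega>. Re (Y 1 \<omega>)))\<^sup>2 +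
    (sample_mean (\<lambda>j \<omega>. Im (Y j \<omega>)) n \<omega> - expectation (\<lambda>\<omega>. Im (Y 1 \<omega>)))\<^sup>2"
  using assms by (simp add: cmod_power2 Re_sample_mean Im_sample_mean)

text \<open>
  The real and the imaginary part of the deviation cannot both be below $\delta/2$ in absolute value.
\<close>

lemma complex_weak_law:
  assumes i1: "integrable M (Y 1)" and \<delta>: "\<delta> > 0"
  shows "(\<lambda>n. prob {\<omega>\<in>space M. \<delta> < cmod (sample_mean Y n \<omega> - expectation (Y 1))}) \<longlonglongrightarrow> 0"
proof (rule tendsto_sandwich[OF _ _ tendsto_const])
  let ?R = "\<lambda>n. {\<omega>\<in>space M. \<delta>/2 \<le> \<bar>sample_mean (\<lambda>j \<omega>. Re (Y j \<omega>)) n \<omega> - expectation (\<lambda>\<omega>. Re (Y 1 \<omega>))\<bar>}"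
  let ?I = "\<lambda>n. {\<omega>\<in>space M. \<delta>/2 \<le> \<bar>sample_mean (\<lambda>j \<omega>. Im (Y j \<omega>)) n \<omega> - expectation (\<lambda>\<omega>. Im (Y 1 \<omega>))\<bar>}"
  have "prob {\<omega>\<in>space M. \<delta> < cmod (sample_mean Y n \<omega> - expectation (Y 1))} \<le> prob (?R n) + prob (?I n)" for n
  proof -
    have sub: "{\<omega>\<in>space M. \<delta> < cmod (sample_mean Y n \<omega> - expectation (Y 1))} \<subseteq> ?R n \<union> ?I n"
    proof safe
      fix \<omega> assume *: "\<delta> < cmod (sample_mean Y n \<omega> - expectation (Y 1))"
        "\<not> \<delta>/2 \<le> \<bar>sample_mean (\<lambda>j \<omega>. Im (Y j \<omega>)) n \<omega> - expectation (\<lambda>\<omega>. Im (Y 1 \<omega>))\<bar>"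
      show "\<delta>/2 \<le> \<bar>sample_mean (\<lambda>j \<omega>. Re (Y j \<omega>)) n \<omega> - expectation (\<lambda>\<omega>. Re (Y 1 \<omega>))\<bar>"
        using * cmod_le[of "sample_mean Y n \<omega> - expectation (Y 1)"] i1
        by (simp add: Re_sample_mean Im_sample_mean)
    qed
    show ?thesis
      by (rule order_trans[OF finite_measure_mono[OF sub] measure_Un_le]) measurable
  qed
  then show "\<forall>\<^sub>F n in sequentially.
      prob {\<omega>\<in>space M. \<delta> < cmod (sample_mean Y n \<omega> - expectation (Y 1))} \<le> prob (?R n) + prob (?I n)"
    by simp
  show "(\<lambda>n. prob (?R n) + prob (?I n)) \<longlonglongrightarrow> 0"
    using tendsto_add[OF Re.weak_law[of "\<delta>/2"] Im.weak_law[of "\<delta>/2"]] i1 \<delta> by simp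
qed simp

context
  assumes sq: "integrable M (\<lambda>\<omega>. (cmod (Y 1 \<omega>))\<^sup>2)"
begin

lemma sq_parts:
  "integrable M (Y 1)" "integrable M (\<lambda>\<omega>. (Re (Y 1 \<omega>))\<^sup>2)" "integrable M (\<lambda>\<omega>. (Im (Y 1 \<omega>))\<^sup>2)"
proof -
  have "integrable M (\<lambda>\<omega>. cmod (Y 1 \<omega>))"
    using square_integrable_imp_integrable[of "\<lambda>\<omega>. cmod (Y 1 \<omega>)"] sq by simp
  then show "integrable M (Y 1)" by (rule integrable_norm_cancel) simp
  show "integrable M (\<lambda>\<omega>. (Re (Y 1 \<omega>))\<^sup>2)"
    by (rule Bochner_Integration.integrable_bound[OF sq]) (auto simp: cmod_power2)
  show "integrable M (\<lambda>\<omega>. (Im (Y 1 \<omega>))\<^sup>2)"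
    by (rule Bochner_Integration.integrable_bound[OF sq]) (auto simp: cmod_power2)
qed

lemma sample_mean_cvariance:
  assumes n: "n \<ge> 1"
  shows "integrable M (\<lambda>\<omega>. (cmod (sample_mean Y n \<omega> - expectation (Y 1)))\<^sup>2)"
    and "real n * expectation (\<lambda>\<omega>. (cmod (sample_mean Y n \<omega> - expectation (Y 1)))\<^sup>2) = cvariance M (Y 1)"
proof -
  note R = Re.sample_mean_variance[OF sq_parts(2) n] and I = Im.sample_mean_variance[OF sq_parts(3) n]
  show "integrable M (\<lambda>\<omega>. (cmod (sample_mean Y n \<omega> - expectation (Y 1)))\<^sup>2)"
    unfolding cmod_centered_mean_sq[OF sq_parts(1)] using R(1) I(1) by simp
  have i: "integrable M (\<lambda>\<omega>. (Re (Y 1 \<omega>) - expectation (\<lambda>\<omega>. Re (Y 1 \<omega>)))\<^sup>2)"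
    "integrable M (\<lambda>\<omega>. (Im (Y 1 \<omega>) - expectation (\<lambda>\<omega>. Im (Y 1 \<omega>)))\<^sup>2)"
    using sq_parts by (auto simp: power2_diff)
  have "cvariance M (Y 1) = variance (\<lambda>\<omega>. Re (Y 1 \<omega>)) + variance (\<lambda>\<omega>. Im (Y 1 \<omega>))"
    using i sq_parts(1) by (simp add: cvariance_def cmod_power2)
  also have "\<dots> = real n * expectation (\<lambda>\<omega>. (cmod (sample_mean Y n \<omega> - expectation (Y 1)))\<^sup>2)"
    unfolding cmod_centered_mean_sq[OF sq_parts(1)] using R I by (simp add: algebra_simps)
  finally show "real n * expectation (\<lambda>\<omega>. (cmod (sample_mean Y n \<omega> - expectation (Y 1)))\<^sup>2) = cvariance M (Y 1)"
    by simp
qed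

text \<open>
  If $|T| > \delta$, then the larger of the real and the imaginary part of $T$ exceeds
  $\delta/2$ in absolute value and carries at least half of $|T|^2$.
\<close>

lemma complex_sq_tail_limit:
  assumes \<delta>: "\<delta> > 0"
  shows "(\<lambda>n. real n * expectation (\<lambda>\<omega>. if cmod (sample_mean Y n \<omega> - expectation (Y 1)) > \<delta>
      then (cmod (sample_mean Y n \<omega> - expectation (Y 1)))\<^sup>2 else 0)) \<longlonglongrightarrow> 0"
proof (rule tendsto_sandwich[OF _ _ tendsto_const])
  define R where "R n \<omega> = sample_mean (\<lambda>j \<omega>. Re (Y j \<omega>)) n \<omega> - expectation (\<lambda>\<omega>. Re (Y 1 \<omega>))" for n \<omega>
  define I where "I n \<omega> = sample_mean (\<lambda>j \<omega>. Im (Y j \<omega>)) n \<omega> - expectation (\<lambda>\<omega>. Im (Y 1 \<omega>))" for n \<omega>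
  define T where "T n \<omega> = cmod (sample_mean Y n \<omega> - expectation (Y 1))" for n \<omega>
  define tl where "tl x = (if \<bar>x\<bar> > \<delta>/2 then x\<^sup>2 else 0)" for x :: real
  have [measurable]: "R n \<in> borel_measurable M" "I n \<in> borel_measurable M" "T n \<in> borel_measurable M" for n
    unfolding R_def[abs_def] I_def[abs_def] T_def[abs_def] by measurable
  have T2: "(T n \<omega>)\<^sup>2 = (R n \<omega>)\<^sup>2 + (I n \<omega>)\<^sup>2" for n \<omega>
    unfolding T_def R_def I_def by (rule cmod_centered_mean_sq[OF sq_parts(1)])
  have nn: "0 \<le> tl x" for x by (simp add: tl_def)
  have pw: "(if T n \<omega> > \<delta> then (T n \<omega>)\<^sup>2 else 0) \<le> 2 * tl (R n \<omega>) + 2 * tl (I n \<omega>)" for n \<omega>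
  proof (cases "T n \<omega> > \<delta>")
    case True
    have half: "\<bar>x\<bar> > \<delta>/2" if "y\<^sup>2 \<le> x\<^sup>2" "(T n \<omega>)\<^sup>2 = x\<^sup>2 + y\<^sup>2" for x y
    proof -
      have "\<delta>\<^sup>2 < (T n \<omega>)\<^sup>2" using True \<delta> by (intro power_strict_mono) auto
      also have "\<dots> \<le> 2 * x\<^sup>2" using that by simp
      also have "\<dots> \<le> (2 * x)\<^sup>2" by (simp add: power_mult_distrib)
      finally show ?thesis using power2_less_imp_less[of \<delta> "\<bar>2 * x\<bar>"] by simp
    qed
    show ?thesis
    proof (cases "(I n \<omega>)\<^sup>2 \<le> (R n \<omega>)\<^sup>2")
      case le: True
      then have "tl (R n \<omega>) = (R n \<omega>)\<^sup>2" using half T2 by (simp add: tl_def)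
      then show ?thesis using le nn[of "I n \<omega>"] True T2[of n \<omega>] by simp
    next
      case le: False
      then have "tl (I n \<omega>) = (I n \<omega>)\<^sup>2" using half[of "R n \<omega>" "I n \<omega>"] T2[of n \<omega>] by (simp add: tl_def)
      then show ?thesis using le nn[of "R n \<omega>"] True T2[of n \<omega>] by simp
    qed
  qed (simp add: tl_def)
  have int: "integrable M (\<lambda>\<omega>. tl (R n \<omega>))" "integrable M (\<lambda>\<omega>. tl (I n \<omega>))" if n: "n \<ge> 1" for n
  proof -
    have m: "tl \<in> borel_measurable borel" unfolding tl_def[abs_def] by measurable
    have le: "norm (tl x) \<le> norm (x\<^sup>2)" for x by (simp add: tl_def)
    show "integrable M (\<lambda>\<omega>. tl (R n \<omega>))"
      by (rule Bochner_Integration.integrable_bound[OF Re.sample_mean_variance(1)[OF sq_parts(2) n]])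
        (use m le in \<open>auto simp flip: R_def\<close>)
    show "integrable M (\<lambda>\<omega>. tl (I n \<omega>))"
      by (rule Bochner_Integration.integrable_bound[OF Im.sample_mean_variance(1)[OF sq_parts(3) n]])
        (use m le in \<open>auto simp flip: I_def\<close>)
  qed
  have "real n * expectation (\<lambda>\<omega>. if T n \<omega> > \<delta> then (T n \<omega>)\<^sup>2 else 0) \<le>
     2 * (real n * expectation (\<lambda>\<omega>. tl (R n \<omega>))) + 2 * (real n * expectation (\<lambda>\<omega>. tl (I n \<omega>)))"
    if n: "n \<ge> 1" for n
  proof -
    have "expectation (\<lambda>\<omega>. if T n \<omega> > \<delta> then (T n \<omega>)\<^sup>2 else 0) \<le>
        expectation (\<lambda>\<omega>. 2 * tl (R n \<omega>) + 2 * tl (I n \<omega>))"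
      by (intro integral_mono_AE' AE_I2 pw) (use int[OF n] nn in auto)
    then have "real n * expectation (\<lambda>\<omega>. if T n \<omega> > \<delta> then (T n \<omega>)\<^sup>2 else 0) \<le>
        real n * expectation (\<lambda>\<omega>. 2 * tl (R n \<omega>) + 2 * tl (I n \<omega>))"
      by (rule mult_left_mono) simp
    then show ?thesis using int[OF n] by (simp add: algebra_simps)
  qed
  then show "\<forall>\<^sub>F n in sequentially. real n * expectation (\<lambda>\<omega>. if cmod (sample_mean Y n \<omega> - expectation (Y 1)) > \<delta>
      then (cmod (sample_mean Y n \<omega> - expectation (Y 1)))\<^sup>2 else 0) \<le>
      2 * (real n * expectation (\<lambda>\<omega>. tl (R n \<omega>))) + 2 * (real n * expectation (\<lambda>\<omega>. tl (I n \<omega>)))"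
    unfolding T_def by (intro eventually_mono[OF eventually_ge_at_top[of 1]]) auto
  have "(\<lambda>n. real n * expectation (\<lambda>\<omega>. tl (R n \<omega>))) \<longlonglongrightarrow> 0" "(\<lambda>n. real n * expectation (\<lambda>\<omega>. tl (I n \<omega>))) \<longlonglongrightarrow> 0"
    unfolding tl_def R_def I_def
    using Re.sq_tail_limit[OF sq_parts(2), of "\<delta>/2"] Im.sq_tail_limit[OF sq_parts(3), of "\<delta>/2"] \<delta> by auto
  from tendsto_add[OF tendsto_mult_right_zero[OF this(1), of 2] tendsto_mult_right_zero[OF this(2), of 2]]
  show "(\<lambda>n. 2 * (real n * expectation (\<lambda>\<omega>. tl (R n \<omega>))) + 2 * (real n * expectation (\<lambda>\<omega>. tl (I n \<omega>)))) \<longlonglongrightarrow> 0"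
    by simp
qed (simp add: Bochner_Integration.integral_nonneg)

end

end

section \<open>Complex variance and means of small modulus\<close>

lemma (in prob_space) cvariance_add_const:
  fixes Z :: "'a \<Rightarrow> complex"
  assumes "integrable M Z"
  shows "cvariance M (\<lambda>\<omega>. Z \<omega> + c) = cvariance M Z"
  using assms by (simp add: cvariance_def prob_space)

lemma cvariance_cmult:
  "cvariance M (\<lambda>\<omega>. c * Z \<omega>) = (cmod c)\<^sup>2 * cvariance M Z"
proof -
  have "(cmod (c * Z \<omega> - (\<integral>\<omega>. c * Z \<omega> \<partial>M)))\<^sup>2 = (cmod c)\<^sup>2 * (cmod (Z \<omega> - (\<integral>\<omega>. Z \<omega> \<partial>M)))\<^sup>2" for \<omega>
    by (simp add: norm_mult power_mult_distrib flip: right_diff_distrib)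
  then show ?thesis by (simp add: cvariance_def)
qed

lemma (in prob_space) sq_integrable_imp_integrable_complex:
  fixes Z :: "'a \<Rightarrow> complex"
  assumes "Z \<in> borel_measurable M" "integrable M (\<lambda>\<omega>. (cmod (Z \<omega>))\<^sup>2)"
  shows "integrable M Z"
  using assms square_integrable_imp_integrable[of "\<lambda>\<omega>. cmod (Z \<omega>)"]
  by (intro integrable_norm_cancel[of M Z]) auto

lemma (in prob_space) integrable_centered_sq:
  fixes Z :: "'a \<Rightarrow> complex"
  assumes [measurable]: "Z \<in> borel_measurable M" and "integrable M (\<lambda>\<omega>. (cmod (Z \<omega>))\<^sup>2)"
  shows "integrable M (\<lambda>\<omega>. (cmod (Z \<omega> - c))\<^sup>2)"
proof (rule Bochner_Integration.integrable_bound)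
  show "integrable M (\<lambda>\<omega>. 2 * (cmod (Z \<omega>))\<^sup>2 + 2 * (cmod c)\<^sup>2)" using assms by auto
  show "AE \<omega> in M. norm ((cmod (Z \<omega> - c))\<^sup>2) \<le> norm (2 * (cmod (Z \<omega>))\<^sup>2 + 2 * (cmod c)\<^sup>2)"
  proof (rule AE_I2)
    fix \<omega>
    have "(cmod (Z \<omega> - c))\<^sup>2 \<le> (cmod (Z \<omega>) + cmod c)\<^sup>2"
      by (intro power_mono norm_triangle_ineq4) simp
    also have "\<dots> \<le> 2 * (cmod (Z \<omega>))\<^sup>2 + 2 * (cmod c)\<^sup>2"
      using sum_squares_bound[of "cmod (Z \<omega>)" "cmod c"] by (simp add: power2_sum)
    finally show "norm ((cmod (Z \<omega> - c))\<^sup>2) \<le> norm (2 * (cmod (Z \<omega>))\<^sup>2 + 2 * (cmod c)\<^sup>2)" by simp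
  qed
qed measurable

lemma (in prob_space) cvariance_le_second_moment:
  fixes Z :: "'a \<Rightarrow> complex"
  assumes [measurable]: "Z \<in> borel_measurable M" and sq: "integrable M (\<lambda>\<omega>. (cmod (Z \<omega>))\<^sup>2)"
  shows "cvariance M Z \<le> expectation (\<lambda>\<omega>. (cmod (Z \<omega>))\<^sup>2)"
proof -
  define m where "m = expectation Z"
  have iZ: "integrable M Z" by (rule sq_integrable_imp_integrable_complex[OF assms])
  define Q where "Q \<omega> = Re (Z \<omega> * cnj m)" for \<omega>
  have eq: "(cmod (Z \<omega> - m))\<^sup>2 = (cmod (Z \<omega>))\<^sup>2 - 2 * Q \<omega> + (cmod m)\<^sup>2" for \<omega>
    unfolding cmod_power2 Q_def by (simp add: power2_eq_square algebra_simps)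
  have "expectation Q = Re (expectation (\<lambda>\<omega>. Z \<omega> * cnj m))"
    unfolding Q_def[abs_def] using iZ by (intro integral_Re) auto
  also have "\<dots> = (cmod m)\<^sup>2"
    unfolding cmod_power2 using iZ by (simp add: m_def power2_eq_square)
  finally have "expectation Q = (cmod m)\<^sup>2" .
  moreover have "integrable M Q" unfolding Q_def[abs_def] using iZ by auto
  ultimately have "cvariance M Z = expectation (\<lambda>\<omega>. (cmod (Z \<omega>))\<^sup>2) - (cmod m)\<^sup>2"
    using sq by (simp add: cvariance_def m_def[symmetric] eq prob_space)
  then show ?thesis by simp
qed

text \<open>
  Young's inequality $2|a||b| \le e|a|^2 + |b|^2/e$, applied to the centred variables. If the second
  moment of $R$ is of smaller order than the variance of $U$, then $R$ does not change the leading
  order, as one sees by fixing $e$ first.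
\<close>

lemma (in prob_space) cvariance_perturbation:
  fixes U R :: "'a \<Rightarrow> complex"
  assumes [measurable]: "U \<in> borel_measurable M" "R \<in> borel_measurable M"
    and sqU: "integrable M (\<lambda>\<omega>. (cmod (U \<omega>))\<^sup>2)" and sqR: "integrable M (\<lambda>\<omega>. (cmod (R \<omega>))\<^sup>2)"
    and e: "e > 0"
  shows "\<bar>cvariance M (\<lambda>\<omega>. U \<omega> + R \<omega>) - cvariance M U\<bar>
    \<le> e * cvariance M U + (1 + 1 / e) * expectation (\<lambda>\<omega>. (cmod (R \<omega>))\<^sup>2)"
proof -
  define a b where "a \<omega> = U \<omega> - expectation U" and "b \<omega> = R \<omega> - expectation R" for \<omega>
  have iU: "integrable M U" and iR: "integrable M R"
    using sqU sqR by (auto intro: sq_integrable_imp_integrable_complex)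
  have ia: "integrable M (\<lambda>\<omega>. (cmod (a \<omega>))\<^sup>2)" and ib: "integrable M (\<lambda>\<omega>. (cmod (b \<omega>))\<^sup>2)"
    unfolding a_def b_def using sqU sqR by (auto intro: integrable_centered_sq)
  have [measurable]: "a \<in> borel_measurable M" "b \<in> borel_measurable M"
    unfolding a_def[abs_def] b_def[abs_def] by measurable
  have young: "\<bar>(cmod (a \<omega> + b \<omega>))\<^sup>2 - (cmod (a \<omega>))\<^sup>2\<bar> \<le> e * (cmod (a \<omega>))\<^sup>2 + (1 + 1/e) * (cmod (b \<omega>))\<^sup>2" for \<omega>
  proof -
    define x y where "x = cmod (a \<omega>)" and "y = cmod (b \<omega>)"
    have xy: "x \<ge> 0" "y \<ge> 0" by (simp_all add: x_def y_def)
    have "0 \<le> (e * x - y)\<^sup>2 / e" using e by simp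
    also have "\<dots> = e * x\<^sup>2 + y\<^sup>2 / e - 2 * x * y"
      using e by (simp add: power2_eq_square field_simps)
    finally have Y: "2 * x * y \<le> e * x\<^sup>2 + y\<^sup>2 / e" by simp
    define t where "t = Re (a \<omega> * cnj (b \<omega>))"
    have eq: "(cmod (a \<omega> + b \<omega>))\<^sup>2 = x\<^sup>2 + 2 * t + y\<^sup>2"
      unfolding t_def x_def y_def cmod_power2 by (simp add: power2_eq_square algebra_simps)
    have "\<bar>t\<bar> \<le> x * y"
      unfolding t_def
      using abs_Re_le_cmod[of "a \<omega> * cnj (b \<omega>)"] unfolding x_def y_def norm_mult complex_mod_cnj .
    then have "\<bar>(cmod (a \<omega> + b \<omega>))\<^sup>2 - x\<^sup>2\<bar> \<le> 2 * x * y + y\<^sup>2"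
      using zero_le_power2[of y] unfolding eq by linarith
    also have "\<dots> \<le> e * x\<^sup>2 + (1 + 1/e) * y\<^sup>2" using Y by (simp add: algebra_simps)
    finally show ?thesis by (simp add: x_def y_def)
  qed
  have ab: "(\<lambda>\<omega>. U \<omega> + R \<omega> - expectation (\<lambda>\<omega>. U \<omega> + R \<omega>)) = (\<lambda>\<omega>. a \<omega> + b \<omega>)"
    using iU iR by (simp add: a_def b_def algebra_simps)
  have iab: "integrable M (\<lambda>\<omega>. (cmod (a \<omega> + b \<omega>))\<^sup>2)"
  proof (rule Bochner_Integration.integrable_bound)
    show "integrable M (\<lambda>\<omega>. (1 + e) * (cmod (a \<omega>))\<^sup>2 + (1 + 1/e) * (cmod (b \<omega>))\<^sup>2)"
      using ia ib by auto
    show "AE \<omega> in M. norm ((cmod (a \<omega> + b \<omega>))\<^sup>2) \<le> norm ((1 + e) * (cmod (a \<omega>))\<^sup>2 + (1 + 1/e) * (cmod (b \<omega>))\<^sup>2)"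
      proof (rule AE_I2)
      fix \<omega>
      have "(cmod (a \<omega> + b \<omega>))\<^sup>2 \<le> (1 + e) * (cmod (a \<omega>))\<^sup>2 + (1 + 1/e) * (cmod (b \<omega>))\<^sup>2"
        using young[of \<omega>] unfolding distrib_right[of 1 e] by linarith
      then show "norm ((cmod (a \<omega> + b \<omega>))\<^sup>2) \<le> norm ((1 + e) * (cmod (a \<omega>))\<^sup>2 + (1 + 1/e) * (cmod (b \<omega>))\<^sup>2)"
        unfolding real_norm_def using zero_le_power2[of "cmod (a \<omega> + b \<omega>)"] by linarith
    qed
  qed measurable
  have "cvariance M (\<lambda>\<omega>. U \<omega> + R \<omega>) - cvariance M U = expectation (\<lambda>\<omega>. (cmod (a \<omega> + b \<omega>))\<^sup>2 - (cmod (a \<omega>))\<^sup>2)"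
    unfolding cvariance_def using iab ia by (simp add: ab[THEN fun_cong] flip: a_def)
  then have "\<bar>cvariance M (\<lambda>\<omega>. U \<omega> + R \<omega>) - cvariance M U\<bar>
      \<le> expectation (\<lambda>\<omega>. \<bar>(cmod (a \<omega> + b \<omega>))\<^sup>2 - (cmod (a \<omega>))\<^sup>2\<bar>)"
    using integral_abs_bound[of M "\<lambda>\<omega>. (cmod (a \<omega> + b \<omega>))\<^sup>2 - (cmod (a \<omega>))\<^sup>2"] by simp
  also have "\<dots> \<le> expectation (\<lambda>\<omega>. e * (cmod (a \<omega>))\<^sup>2 + (1 + 1/e) * (cmod (b \<omega>))\<^sup>2)"
    by (intro integral_mono young) (use ia ib iab in auto)
  also have "\<dots> = e * cvariance M U + (1 + 1/e) * cvariance M R"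
    using ia ib by (simp add: cvariance_def a_def b_def)
  also have "\<dots> \<le> e * cvariance M U + (1 + 1/e) * expectation (\<lambda>\<omega>. (cmod (R \<omega>))\<^sup>2)"
    using e by (intro add_left_mono mult_left_mono cvariance_le_second_moment sqR) auto
  finally show ?thesis .
qed

lemma eventually_index_mult_ge:
  fixes r k :: real
  assumes "r > 0"
  shows "\<forall>\<^sub>F n in sequentially. n \<ge> 1 \<and> real n * r \<ge> k"
proof (rule eventually_mono[OF eventually_ge_at_top[of "max 1 (nat \<lceil>k / r\<rceil>)"]])
  fix n assume n: "max 1 (nat \<lceil>k / r\<rceil>) \<le> n"
  then have "k / r \<le> real n" by linarith
  then show "n \<ge> 1 \<and> real n * r \<ge> k" using n assms by (simp add: divide_simps)
qed

lemma cvariance_nonneg: "cvariance M Z \<ge> 0"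
  by (simp add: cvariance_def Bochner_Integration.integral_nonneg)

context complex_iid_sequence
begin

context
  fixes u :: complex and r :: real
  assumes u: "cmod u = 1" and pos: "AE \<omega> in M. Re (u * Y 1 \<omega>) > 0" and r: "r > 0"
    and neg: "integrable M (\<lambda>\<omega>. Re (u * Y 1 \<omega>) powr (- r))"
begin

interpretation W: real_iid_sequence M "\<lambda>j \<omega>. Re (u * Y j \<omega>)"
  by (rule real_iid_image) simp

text \<open>
  The half-plane assumption enters here: multiplication by a unimodular $u$ does not change the
  modulus of the mean, and the real parts of the $u Y_j$ do not cancel.
\<close>

lemma cmod_mean_ge: "sample_mean (\<lambda>j \<omega>. Re (u * Y j \<omega>)) n \<omega> \<le> cmod (sample_mean Y n \<omega>)"
  using complex_Re_le_cmod[of "u * sample_mean Y n \<omega>"]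
  unfolding sample_mean_Re_mult norm_mult u by simp

text \<open>
  The Chernoff step: on $|S| \le c$ one may trade the exponent $k$ for $nr$ at the price of
  $c^{nr - k}$.
\<close>

lemma mean_small_modulus_bound:
  assumes n: "n \<ge> 1" "real n * r \<ge> k"
  shows "AE \<omega> in M. \<forall>c>0. cmod (sample_mean Y n \<omega>) \<le> c \<longrightarrow>
    cmod (sample_mean Y n \<omega>) powr (- k) \<le> c powr (real n * r - k) *
      sample_mean (\<lambda>j \<omega>. Re (u * Y j \<omega>)) n \<omega> powr (- (real n * r))"
  using W.sample_mean_negative_moment(1)[OF pos r neg n(1)]
proof eventually_elim
  case (elim \<omega>)
  let ?S = "cmod (sample_mean Y n \<omega>)" and ?m = "sample_mean (\<lambda>j \<omega>. Re (u * Y j \<omega>)) n \<omega>"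
  have S: "?S > 0" using elim cmod_mean_ge[of n \<omega>] by linarith
  show ?case
  proof (intro allI impI)
    fix c :: real assume c: "c > 0" "?S \<le> c"
    have "?S powr (- k) = ?S powr (real n * r - k) * ?S powr (- (real n * r))"
      using S by (simp flip: powr_add)
    also have "\<dots> \<le> c powr (real n * r - k) * ?m powr (- (real n * r))"
      using S c n r elim cmod_mean_ge[of n \<omega>]
      by (intro mult_mono powr_mono2 powr_mono2') auto
    finally show "?S powr (- k) \<le> c powr (real n * r - k) * ?m powr (- (real n * r))" .
  qed
qed

lemma integrable_mean_powr:
  assumes n: "n \<ge> 1" "real n * r \<ge> k" and k: "k \<ge> 0"
  shows "integrable M (\<lambda>\<omega>. cmod (sample_mean Y n \<omega>) powr (- k))"
proof (rule Bochner_Integration.integrable_bound)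
  let ?m = "\<lambda>\<omega>. sample_mean (\<lambda>j \<omega>. Re (u * Y j \<omega>)) n \<omega> powr (- (real n * r))"
  show "integrable M (\<lambda>\<omega>. 1 + ?m \<omega>)"
    using W.sample_mean_negative_moment(2)[OF pos r neg n(1)] by auto
  show "AE \<omega> in M. norm (cmod (sample_mean Y n \<omega>) powr (- k)) \<le> norm (1 + ?m \<omega>)"
    using mean_small_modulus_bound[OF n]
  proof eventually_elim
    case (elim \<omega>)
    show ?case
    proof (cases "cmod (sample_mean Y n \<omega>) \<le> 1")
      case True
      then show ?thesis using elim[rule_format, of 1] by simp
    next
      case False
      then have "cmod (sample_mean Y n \<omega>) powr (- k) \<le> cmod (sample_mean Y n \<omega>) powr 0"
        using k by (intro powr_mono) auto
      moreover have "cmod (sample_mean Y n \<omega>) powr 0 = 1" using False by auto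
      moreover have "?m \<omega> \<ge> 0" by (rule powr_ge_zero)
      ultimately show ?thesis
        using powr_ge_zero[of "cmod (sample_mean Y n \<omega>)" "- k"] unfolding real_norm_def by linarith
    qed
  qed
qed measurable

lemma eventually_integrable_mean_powr:
  assumes "k \<ge> 0"
  shows "\<forall>\<^sub>F n in sequentially. integrable M (\<lambda>\<omega>. cmod (sample_mean Y n \<omega>) powr (- k))"
  using eventually_index_mult_ge[OF r, of k]
  by eventually_elim (use integrable_mean_powr assms in blast)

text \<open>
  With $A = E[(\mathrm{Re}(u Y_1))^{-r}]$ the expectation is at most $c^{-k} (c^r A)^n$, which is
  exponentially small as soon as $c^r A < 1$.
\<close>

lemma mean_small_modulus_negligible:
  assumes k: "k \<ge> 0"
  obtains c where "c > 0"
    "(\<lambda>n. real n * expectation (\<lambda>\<omega>. if cmod (sample_mean Y n \<omega>) \<le> c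
        then cmod (sample_mean Y n \<omega>) powr (- k) else 0)) \<longlonglongrightarrow> 0"
proof -
  define A where "A = expectation (\<lambda>\<omega>. Re (u * Y 1 \<omega>) powr (- r))"
  have A: "A \<ge> 0" unfolding A_def by (rule Bochner_Integration.integral_nonneg) simp
  \<comment> \<open>The added 2 in the denominator keeps c positive when A = 0.\<close>
  define c where "c = (1 / (2 * A + 2)) powr (1 / r)"
  have c: "c > 0" using A by (simp add: c_def)
  have "c powr r = 1 / (2 * A + 2)"
    using A r by (simp add: c_def powr_powr)
  then have "c powr r * A = A / (2 * A + 2)" by simp
  also have "\<dots> \<le> 1 / 2" using A by (simp add: divide_simps)
  finally have cA: "c powr r * A \<le> 1 / 2" .
  let ?E = "\<lambda>n. expectation (\<lambda>\<omega>. if cmod (sample_mean Y n \<omega>) \<le> c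
        then cmod (sample_mean Y n \<omega>) powr (- k) else 0)"
  have bound: "real n * ?E n \<le> real n * (c powr (- k) * (1/2) ^ n)" if n: "n \<ge> 1" "real n * r \<ge> k" for n
  proof (rule mult_left_mono)
    let ?m = "\<lambda>\<omega>. sample_mean (\<lambda>j \<omega>. Re (u * Y j \<omega>)) n \<omega> powr (- (real n * r))"
    note im = W.sample_mean_negative_moment(2,3)[OF pos r neg n(1)]
    have "?E n \<le> expectation (\<lambda>\<omega>. c powr (real n * r - k) * ?m \<omega>)"
    proof (rule integral_mono_AE')
      show "integrable M (\<lambda>\<omega>. c powr (real n * r - k) * ?m \<omega>)" using im by auto
      show "AE \<omega> in M. (if cmod (sample_mean Y n \<omega>) \<le> c then cmod (sample_mean Y n \<omega>) powr (- k) else 0)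
          \<le> c powr (real n * r - k) * ?m \<omega>"
        using mean_small_modulus_bound[OF n] by eventually_elim (use c in auto)
    qed simp
    also have "\<dots> \<le> c powr (real n * r - k) * A ^ n"
      using im by (auto simp: A_def intro!: mult_left_mono)
    also have "c powr (real n * r - k) = c powr (- k) * (c powr r) ^ n"
      using c by (simp add: powr_diff powr_minus divide_simps mult.commute powr_powr flip: powr_realpow)
    also have "c powr (- k) * (c powr r) ^ n * A ^ n = c powr (- k) * (c powr r * A) ^ n"
      by (simp add: power_mult_distrib)
    also have "\<dots> \<le> c powr (- k) * (1/2) ^ n"
      using cA A by (intro mult_left_mono power_mono) auto
    finally show "?E n \<le> c powr (- k) * (1/2) ^ n" .
  qed simp
  have "(\<lambda>n. real n * ?E n) \<longlonglongrightarrow> 0"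
  proof (rule tendsto_sandwich[OF _ _ tendsto_const])
    show "\<forall>\<^sub>F n in sequentially. real n * ?E n \<le> real n * (c powr (- k) * (1/2) ^ n)"
      using eventually_index_mult_ge[OF r, of k] by eventually_elim (use bound in blast)
    have "(\<lambda>n. c powr (- k) * (real n * (1/2) ^ n)) \<longlonglongrightarrow> c powr (- k) * 0"
      by (intro tendsto_mult_left powser_times_n_limit_0) simp
    then show "(\<lambda>n. real n * (c powr (- k) * (1/2) ^ n)) \<longlonglongrightarrow> 0"
      by (simp add: mult_ac)
  qed (simp add: Bochner_Integration.integral_nonneg)
  with c show ?thesis by (rule that)
qed

end

end

section \<open>The delta method under a second moment\<close>

context complex_iid_sequence
begin

text \<open>
  Three regimes of $T = S_n - \mu$ are distinguished. For $|T| \le \delta$ the remainder is at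
  most $\epsilon |T|$ by differentiability, and $n E[|T|^2]$ is constant. For $|T| > \delta$ every
  bounded quantity is at most a constant multiple of $|T|^2$, whose tail is $o(1/n)$; this covers
  $g(S_n)$ too as long as $|S_n| > c$. Finally, the growth bound on $g$ reduces $|S_n| \le c$
  to a negative moment of a mean of small modulus.
\<close>

lemma remainder_second_moment_limit:
  fixes g :: "complex \<Rightarrow> complex"
  assumes sq: "integrable M (\<lambda>\<omega>. (cmod (Y 1 \<omega>))\<^sup>2)"
    and u: "cmod u = 1" and pos: "AE \<omega> in M. Re (u * Y 1 \<omega>) > 0" and r: "r > 0"
    and neg: "integrable M (\<lambda>\<omega>. Re (u * Y 1 \<omega>) powr (- r))"
    and [measurable]: "g \<in> borel_measurable borel"
    and D: "(g has_field_derivative D) (at (expectation (Y 1)))"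
    and gb: "\<And>w. (cmod (g w))\<^sup>2 \<le> cmod w powr (- k)" and k: "k \<ge> 0"
  defines "R \<equiv> \<lambda>n \<omega>. g (sample_mean Y n \<omega>) - g (expectation (Y 1)) - D * (sample_mean Y n \<omega> - expectation (Y 1))"
  shows "\<forall>\<^sub>F n in sequentially. integrable M (\<lambda>\<omega>. (cmod (R n \<omega>))\<^sup>2)"
    and "(\<lambda>n. real n * expectation (\<lambda>\<omega>. (cmod (R n \<omega>))\<^sup>2)) \<longlonglongrightarrow> 0"
proof -
  define \<mu> where "\<mu> = expectation (Y 1)"
  define V where "V = cvariance M (Y 1)"
  have V: "V \<ge> 0" by (simp add: V_def cvariance_nonneg)
  define T where "T n \<omega> = sample_mean Y n \<omega> - \<mu>" for n \<omega>
  have [measurable]: "T n \<in> borel_measurable M" "R n \<in> borel_measurable M" for n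
    unfolding T_def[abs_def] R_def by measurable
  have R: "R n \<omega> = g (sample_mean Y n \<omega>) - g \<mu> - D * T n \<omega>" for n \<omega>
    by (simp add: R_def T_def \<mu>_def)
  have iT: "integrable M (\<lambda>\<omega>. (cmod (T n \<omega>))\<^sup>2)"
    and eT: "real n * expectation (\<lambda>\<omega>. (cmod (T n \<omega>))\<^sup>2) = V" if "n \<ge> 1" for n
    using sample_mean_cvariance[OF sq that] by (simp_all add: T_def \<mu>_def V_def)
  have R3: "(cmod (R n \<omega>))\<^sup>2 \<le> 3 * (cmod (sample_mean Y n \<omega>) powr (- k) + (cmod (g \<mu>))\<^sup>2 + (cmod D)\<^sup>2 * (cmod (T n \<omega>))\<^sup>2)" for n \<omega>
  proof -
    have sq3: "(a + b + c)\<^sup>2 \<le> 3 * (a\<^sup>2 + b\<^sup>2 + c\<^sup>2)" for a b c :: real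
      using sum_squares_bound[of a b] sum_squares_bound[of b c] sum_squares_bound[of a c]
      by (simp add: power2_eq_square algebra_simps)
    have "cmod (R n \<omega>) \<le> cmod (g (sample_mean Y n \<omega>)) + cmod (g \<mu>) + cmod D * cmod (T n \<omega>)"
      unfolding R norm_mult[symmetric]
      by (rule order_trans[OF norm_triangle_ineq4 add_right_mono[OF norm_triangle_ineq4]])
    then have "(cmod (R n \<omega>))\<^sup>2 \<le> (cmod (g (sample_mean Y n \<omega>)) + cmod (g \<mu>) + cmod D * cmod (T n \<omega>))\<^sup>2"
      by (intro power_mono) auto
    also note sq3
    finally show ?thesis using gb[of "sample_mean Y n \<omega>"] by (simp add: power_mult_distrib)
  qed
  have iR: "integrable M (\<lambda>\<omega>. (cmod (R n \<omega>))\<^sup>2)" if n: "n \<ge> 1" "real n * r \<ge> k" for n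
  proof (rule Bochner_Integration.integrable_bound)
    show "integrable M (\<lambda>\<omega>. 3 * (cmod (sample_mean Y n \<omega>) powr (- k) + (cmod (g \<mu>))\<^sup>2 + (cmod D)\<^sup>2 * (cmod (T n \<omega>))\<^sup>2))"
      using integrable_mean_powr[OF u pos r neg n k] iT[OF n(1)] by auto
    show "AE \<omega> in M. norm ((cmod (R n \<omega>))\<^sup>2) \<le>
        norm (3 * (cmod (sample_mean Y n \<omega>) powr (- k) + (cmod (g \<mu>))\<^sup>2 + (cmod D)\<^sup>2 * (cmod (T n \<omega>))\<^sup>2))"
      by (intro AE_I2) (use R3 in \<open>auto intro: order_trans[OF _ abs_ge_self]\<close>)
  qed measurable
  have ev: "\<forall>\<^sub>F n in sequentially. n \<ge> 1 \<and> real n * r \<ge> k"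
    by (rule eventually_index_mult_ge[OF r])
  show "\<forall>\<^sub>F n in sequentially. integrable M (\<lambda>\<omega>. (cmod (R n \<omega>))\<^sup>2)"
    using ev by eventually_elim (use iR in blast)
  obtain c where c: "c > 0" and small: "(\<lambda>n. real n * expectation (\<lambda>\<omega>. if cmod (sample_mean Y n \<omega>) \<le> c
        then cmod (sample_mean Y n \<omega>) powr (- k) else 0)) \<longlonglongrightarrow> 0"
    using mean_small_modulus_negligible[OF u pos r neg k] by blast
  define sm where "sm n \<omega> = (if cmod (sample_mean Y n \<omega>) \<le> c then cmod (sample_mean Y n \<omega>) powr (- k) else 0)" for n \<omega>
  have [measurable]: "sm n \<in> borel_measurable M" for n
    unfolding sm_def[abs_def] by measurable
  have ism: "integrable M (sm n)" if n: "n \<ge> 1" "real n * r \<ge> k" for n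
    by (rule Bochner_Integration.integrable_bound[OF integrable_mean_powr[OF u pos r neg n k]])
      (auto simp: sm_def)
  show "(\<lambda>n. real n * expectation (\<lambda>\<omega>. (cmod (R n \<omega>))\<^sup>2)) \<longlonglongrightarrow> 0"
  proof (rule LIMSEQ_I)
    fix e :: real assume e: "e > 0"
    \<comment> \<open>Makes the contribution of the near regime at most e / 2; the added 1 covers V = 0.\<close>
    define \<epsilon> where "\<epsilon> = sqrt (e / (2 * V + 1))"
    have \<epsilon>: "\<epsilon> > 0" using e V by (simp add: \<epsilon>_def)
    have \<epsilon>V: "\<epsilon>\<^sup>2 * V \<le> e / 2"
    proof -
      have "\<epsilon>\<^sup>2 * V = e * (V / (2 * V + 1))" using e V by (simp add: \<epsilon>_def)
      also have "\<dots> \<le> e * (1 / 2)" using e V by (intro mult_left_mono) (auto simp: divide_simps)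
      finally show ?thesis by simp
    qed
    obtain d where d: "d > 0" and lin: "\<And>w. cmod (w - \<mu>) < d \<Longrightarrow> cmod (g w - g \<mu> - D * (w - \<mu>)) \<le> \<epsilon> * cmod (w - \<mu>)"
      using D \<epsilon> unfolding has_field_derivative_def has_derivative_at_alt \<mu>_def[symmetric] by metis
    define \<delta> where "\<delta> = d / 2"
    have \<delta>: "\<delta> > 0" "\<delta> < d" using d by (simp_all add: \<delta>_def)
    define tl where "tl n \<omega> = (if cmod (T n \<omega>) > \<delta> then (cmod (T n \<omega>))\<^sup>2 else 0)" for n \<omega>
    have [measurable]: "tl n \<in> borel_measurable M" for n
      unfolding tl_def[abs_def] by measurable
    have itl: "integrable M (tl n)" if n: "n \<ge> 1" for n
      by (rule Bochner_Integration.integrable_bound[OF iT[OF n]]) (auto simp: tl_def)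
    define C where "C = 3 * (c powr (- k) / \<delta>\<^sup>2 + (cmod (g \<mu>))\<^sup>2 / \<delta>\<^sup>2 + (cmod D)\<^sup>2)"
    have C: "C \<ge> 0" by (simp add: C_def)
    have pw: "(cmod (R n \<omega>))\<^sup>2 \<le> \<epsilon>\<^sup>2 * (cmod (T n \<omega>))\<^sup>2 + C * tl n \<omega> + 3 * sm n \<omega>" for n \<omega>
    proof (cases "cmod (T n \<omega>) > \<delta>")
      case False
      then have "cmod (R n \<omega>) \<le> \<epsilon> * cmod (T n \<omega>)"
        using lin[of "sample_mean Y n \<omega>"] \<delta> by (simp add: R T_def)
      then have "(cmod (R n \<omega>))\<^sup>2 \<le> (\<epsilon> * cmod (T n \<omega>))\<^sup>2" by (rule power_mono) simp
      moreover have "0 \<le> 3 * sm n \<omega>" "0 \<le> C * tl n \<omega>" using C by (simp_all add: sm_def tl_def)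
      ultimately show ?thesis by (simp add: power_mult_distrib)
    next
      case True
      define t where "t = (cmod (T n \<omega>))\<^sup>2"
      have "\<delta>\<^sup>2 \<le> t" unfolding t_def using True \<delta> by (intro power_mono) auto
      then have t: "1 \<le> t / \<delta>\<^sup>2" using \<delta> by simp
      \<comment> \<open>Far from the mean, constants are absorbed into a multiple of the squared deviation.\<close>
      have scale: "x \<le> x / \<delta>\<^sup>2 * t" if "x \<ge> 0" for x
        using mult_left_mono[OF t that] by simp
      have "cmod (sample_mean Y n \<omega>) powr (- k) \<le> sm n \<omega> + c powr (- k)"
      proof (cases "cmod (sample_mean Y n \<omega>) \<le> c")
        case False
        then show ?thesis using c k by (auto simp: sm_def intro!: powr_mono2')
      qed (simp add: sm_def)
      also have "c powr (- k) \<le> c powr (- k) / \<delta>\<^sup>2 * t" by (rule scale) simp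
      finally have "(cmod (R n \<omega>))\<^sup>2 \<le> 3 * (sm n \<omega> + c powr (- k) / \<delta>\<^sup>2 * t + (cmod (g \<mu>))\<^sup>2 / \<delta>\<^sup>2 * t + (cmod D)\<^sup>2 * t)"
        using R3[of n \<omega>] scale[of "(cmod (g \<mu>))\<^sup>2"] unfolding t_def by simp
      also have "\<dots> = C * t + 3 * sm n \<omega>" by (simp add: C_def algebra_simps)
      also have "\<dots> = C * tl n \<omega> + 3 * sm n \<omega>" using True by (simp add: tl_def t_def)
      finally show ?thesis
        using mult_nonneg_nonneg[OF zero_le_power2[of \<epsilon>] zero_le_power2[of "cmod (T n \<omega>)"]] by linarith
    qed
    have "(\<lambda>n. real n * expectation (tl n)) \<longlonglongrightarrow> 0"
      unfolding tl_def[abs_def] T_def \<mu>_def by (rule complex_sq_tail_limit[OF sq \<delta>(1)])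
    from tendsto_add[OF tendsto_mult_right_zero[OF this, of C] tendsto_mult_right_zero[OF small, of 3]]
    have "(\<lambda>n. C * (real n * expectation (tl n)) + 3 * (real n * expectation (sm n))) \<longlonglongrightarrow> 0"
      unfolding sm_def[abs_def] by simp
    then have "\<forall>\<^sub>F n in sequentially. C * (real n * expectation (tl n)) + 3 * (real n * expectation (sm n)) < e / 2"
      using e by (intro order_tendstoD(2)) auto
    with ev have "\<forall>\<^sub>F n in sequentially. norm (real n * expectation (\<lambda>\<omega>. (cmod (R n \<omega>))\<^sup>2) - 0) < e"
    proof eventually_elim
      case (elim n)
      have "expectation (\<lambda>\<omega>. (cmod (R n \<omega>))\<^sup>2) \<le> expectation (\<lambda>\<omega>. \<epsilon>\<^sup>2 * (cmod (T n \<omega>))\<^sup>2 + C * tl n \<omega> + 3 * sm n \<omega>)"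
        by (intro integral_mono pw) (use iR[of n] iT[of n] itl[of n] ism[of n] elim in auto)
      also have "\<dots> = \<epsilon>\<^sup>2 * expectation (\<lambda>\<omega>. (cmod (T n \<omega>))\<^sup>2) + C * expectation (tl n) + 3 * expectation (sm n)"
        using iT[of n] itl[of n] ism[of n] elim by simp
      finally have "real n * expectation (\<lambda>\<omega>. (cmod (R n \<omega>))\<^sup>2) \<le> real n * \<dots>"
        by (rule mult_left_mono) simp
      also have "\<dots> = \<epsilon>\<^sup>2 * V + (C * (real n * expectation (tl n)) + 3 * (real n * expectation (sm n)))"
        using eT[of n] elim by (simp add: algebra_simps)
      also have "\<dots> < e" using \<epsilon>V elim by linarith
      finally show ?case by (simp add: Bochner_Integration.integral_nonneg)
    qed
    then show "\<exists>no. \<forall>n\<ge>no. norm (real n * expectation (\<lambda>\<omega>. (cmod (R n \<omega>))\<^sup>2) - 0) < e"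
      unfolding eventually_sequentially .
  qed
qed

text \<open>
  Up to an additive constant, $g(S_n)$ is the linear part $D (S_n - \mu)$, whose variance is exactly
  the claimed limit divided by $n$, plus a remainder with second moment $o(1/n)$. The assumptions
  replace boundedness of $g$ by a growth condition at its pole.
\<close>

theorem delta_method_cvariance:
  fixes g :: "complex \<Rightarrow> complex"
  assumes sq: "integrable M (\<lambda>\<omega>. (cmod (Y 1 \<omega>))\<^sup>2)"
    and u: "cmod u = 1" and pos: "AE \<omega> in M. Re (u * Y 1 \<omega>) > 0" and r: "r > 0"
    and neg: "integrable M (\<lambda>\<omega>. Re (u * Y 1 \<omega>) powr (- r))"
    and g [measurable]: "g \<in> borel_measurable borel"
    and D: "(g has_field_derivative D) (at (expectation (Y 1)))"
    and gb: "\<And>w. (cmod (g w))\<^sup>2 \<le> cmod w powr (- k)" and k: "k \<ge> 0"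
  shows "(\<lambda>n. real n * cvariance M (\<lambda>\<omega>. g (sample_mean Y n \<omega>)))
    \<longlonglongrightarrow> (cmod D)\<^sup>2 * cvariance M (Y 1)"
proof (rule LIMSEQ_I)
  fix e :: real assume e: "e > 0"
  define \<mu> where "\<mu> = expectation (Y 1)"
  define L where "L = (cmod D)\<^sup>2 * cvariance M (Y 1)"
  have L: "L \<ge> 0" by (simp add: L_def cvariance_nonneg)
  define R where "R n \<omega> = g (sample_mean Y n \<omega>) - g \<mu> - D * (sample_mean Y n \<omega> - \<mu>)" for n \<omega>
  define U where "U n \<omega> = D * (sample_mean Y n \<omega> + (- \<mu>))" for n \<omega>
  note rem = remainder_second_moment_limit[OF sq u pos r neg g D gb k, folded \<mu>_def, folded R_def]
  have [measurable]: "U n \<in> borel_measurable M" "R n \<in> borel_measurable M" for n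
    unfolding U_def[abs_def] R_def[abs_def] by measurable
  note i1 = sq_parts(1)[OF sq]
  have sqU: "integrable M (\<lambda>\<omega>. (cmod (U n \<omega>))\<^sup>2)" and varU: "real n * cvariance M (U n) = L" if n: "n \<ge> 1" for n
  proof -
    note S = sample_mean_cvariance[OF sq n]
      and E = integrable_sample_mean[OF i1, of n] expectation_sample_mean[OF i1 n]
    show "integrable M (\<lambda>\<omega>. (cmod (U n \<omega>))\<^sup>2)"
      using S(1) by (simp add: U_def norm_mult power_mult_distrib \<mu>_def)
    have "cvariance M (U n) = (cmod D)\<^sup>2 * cvariance M (sample_mean Y n)"
      unfolding U_def[abs_def] by (subst cvariance_cmult, subst cvariance_add_const[OF E(1)]) (rule refl)
    then show "real n * cvariance M (U n) = L"
      using S(2) E(2) by (simp add: cvariance_def L_def)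
  qed
  define \<eta> where "\<eta> = e / (2 * (L + 1))"
  have \<eta>: "\<eta> > 0" using e L by (simp add: \<eta>_def)
  have \<eta>L: "\<eta> * L < e / 2"
  proof -
    have "\<eta> * L < \<eta> * (L + 1)" using \<eta> by simp
    also have "\<dots> = e / 2" using L by (simp add: \<eta>_def divide_simps)
    finally show ?thesis .
  qed
  have "(\<lambda>n. (1 + 1 / \<eta>) * (real n * expectation (\<lambda>\<omega>. (cmod (R n \<omega>))\<^sup>2))) \<longlonglongrightarrow> 0"
    by (rule tendsto_mult_right_zero[OF rem(2)])
  then have "\<forall>\<^sub>F n in sequentially. (1 + 1 / \<eta>) * (real n * expectation (\<lambda>\<omega>. (cmod (R n \<omega>))\<^sup>2)) < e / 2"
    using e by (intro order_tendstoD(2)) auto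
  with rem(1) eventually_ge_at_top[of 1]
  have "\<forall>\<^sub>F n in sequentially. norm (real n * cvariance M (\<lambda>\<omega>. g (sample_mean Y n \<omega>)) - L) < e"
  proof eventually_elim
    case (elim n)
    have iUR: "integrable M (\<lambda>\<omega>. U n \<omega> + R n \<omega>)"
      using sqU[of n] elim by (intro Bochner_Integration.integrable_add sq_integrable_imp_integrable_complex) auto
    have "cvariance M (\<lambda>\<omega>. g (sample_mean Y n \<omega>)) = cvariance M (\<lambda>\<omega>. (U n \<omega> + R n \<omega>) + g \<mu>)"
      by (simp add: U_def R_def)
    also have "\<dots> = cvariance M (\<lambda>\<omega>. U n \<omega> + R n \<omega>)" by (rule cvariance_add_const[OF iUR])
    finally have "real n * cvariance M (\<lambda>\<omega>. g (sample_mean Y n \<omega>)) - L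
        = real n * (cvariance M (\<lambda>\<omega>. U n \<omega> + R n \<omega>) - cvariance M (U n))"
      using varU[of n] elim by (simp add: algebra_simps)
    then have "norm (real n * cvariance M (\<lambda>\<omega>. g (sample_mean Y n \<omega>)) - L)
        = real n * \<bar>cvariance M (\<lambda>\<omega>. U n \<omega> + R n \<omega>) - cvariance M (U n)\<bar>"
      by (simp add: abs_mult)
    also have "\<dots> \<le> real n * (\<eta> * cvariance M (U n) + (1 + 1 / \<eta>) * expectation (\<lambda>\<omega>. (cmod (R n \<omega>))\<^sup>2))"
      by (intro mult_left_mono cvariance_perturbation) (use elim sqU[of n] \<eta> in auto)
    also have "\<dots> = \<eta> * (real n * cvariance M (U n)) + (1 + 1 / \<eta>) * (real n * expectation (\<lambda>\<omega>. (cmod (R n \<omega>))\<^sup>2))"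
      by (simp add: algebra_simps)
    also have "\<eta> * (real n * cvariance M (U n)) < e / 2" using varU[of n] elim \<eta>L by simp
    also note elim(3)
    finally show ?case by simp
  qed
  then show "\<exists>no. \<forall>n\<ge>no. norm (real n * cvariance M (\<lambda>\<omega>. g (sample_mean Y n \<omega>)) - (cmod D)\<^sup>2 * cvariance M (Y 1)) < e"
    unfolding eventually_sequentially L_def .
qed

end

section \<open>Characteristic functions under an infinite second moment\<close>

text \<open>
  Taylor estimates of $e^{ix}$ of order zero, one and two.
\<close>

lemma one_minus_cos_bounds:
  fixes x :: real
  shows "1 - cos x \<le> \<bar>x\<bar>" "1 - cos x \<le> x\<^sup>2 / 2" "\<bar>x\<bar> \<le> 1 \<Longrightarrow> x\<^sup>2 / 3 \<le> 1 - cos x"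
proof -
  have Re: "\<bar>Re z\<bar> \<le> b" if "cmod z \<le> b" for z b
    using abs_Re_le_cmod[of z] that by linarith
  have "\<bar>Re (iexp x - 1)\<bar> \<le> \<bar>x\<bar>"
    using Re[OF iexp_approx1[of x 0]] by simp
  then show "1 - cos x \<le> \<bar>x\<bar>" by (simp flip: cis_conv_exp)
  have "\<bar>Re (iexp x - (\<Sum>k\<le>1. (\<i> * x) ^ k / fact k))\<bar> \<le> x\<^sup>2 / 2"
    using Re[OF iexp_approx1[of x 1]] by (simp add: power2_eq_square abs_mult_self_eq numeral_2_eq_2)
  then show "1 - cos x \<le> x\<^sup>2 / 2" by (simp add: One_nat_def flip: cis_conv_exp)
  assume x: "\<bar>x\<bar> \<le> 1"
  have "\<bar>Re (iexp x - (\<Sum>k\<le>2. (\<i> * x) ^ k / fact k))\<bar> \<le> \<bar>x\<bar> ^ 3 / 6"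
    using Re[OF iexp_approx1[of x 2]] by (simp add: fact_numeral)
  then have "\<bar>cos x - (1 - x\<^sup>2 / 2)\<bar> \<le> \<bar>x\<bar> ^ 3 / 6"
    by (simp add: numeral_2_eq_2 flip: cis_conv_exp)
  moreover have "\<bar>x\<bar> ^ 3 \<le> x\<^sup>2"
    using power_decreasing[of 2 3 "\<bar>x\<bar>"] x by simp
  ultimately show "x\<^sup>2 / 3 \<le> 1 - cos x" by linarith
qed

text \<open>
  Otherwise monotone convergence would make the second moment finite.
\<close>

lemma (in prob_space) clipped_second_moment_unbounded:
  fixes X :: "'a \<Rightarrow> real"
  assumes [measurable]: "X \<in> borel_measurable M" and inf: "\<not> integrable M (\<lambda>\<omega>. (X \<omega>)\<^sup>2)"
  obtains L where "L > 0" "K \<le> expectation (\<lambda>\<omega>. (clip L (X \<omega>))\<^sup>2)"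
proof (rule ccontr)
  assume neg: "\<not> thesis"
  let ?E = "\<lambda>i. expectation (\<lambda>\<omega>. (clip (real i) (X \<omega>))\<^sup>2)"
  have int: "integrable M (\<lambda>\<omega>. (clip (real i) (X \<omega>))\<^sup>2)" for i
  proof (rule integrable_const_bound[of _ "(real i)\<^sup>2"])
    show "AE \<omega> in M. norm ((clip (real i) (X \<omega>))\<^sup>2) \<le> (real i)\<^sup>2"
      by (intro AE_I2) (auto simp: clip_def abs_le_square_iff[symmetric])
  qed measurable
  have mono: "(clip (real i) x)\<^sup>2 \<le> (clip (real j) x)\<^sup>2" if "i \<le> j" for i j x
    using that by (auto simp: clip_def)
  have "?E i \<le> K" for i
  proof (cases "i = 0")
    case True
    have "?E 0 \<le> ?E 1" by (intro integral_mono int mono) simp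
    also have "?E 1 \<le> K" using neg that[of 1] by force
    finally show ?thesis using True by simp
  next
    case False
    then show ?thesis using neg that[of "real i"] by force
  qed
  moreover have "incseq ?E"
    by (intro incseq_SucI integral_mono int mono) simp
  ultimately obtain l where l: "?E \<longlonglongrightarrow> l"
    using incseq_convergent[of ?E K] by blast
  have "integrable M (\<lambda>\<omega>. (X \<omega>)\<^sup>2)"
  proof (rule integrable_monotone_convergence[OF int _ _ l])
    show "AE \<omega> in M. mono (\<lambda>i. (clip (real i) (X \<omega>))\<^sup>2)"
      by (intro AE_I2 monoI mono)
    show "AE \<omega> in M. (\<lambda>i. (clip (real i) (X \<omega>))\<^sup>2) \<longlonglongrightarrow> (X \<omega>)\<^sup>2"
    proof (intro AE_I2 tendsto_eventually)
      fix \<omega>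
      show "\<forall>\<^sub>F i in sequentially. (clip (real i) (X \<omega>))\<^sup>2 = (X \<omega>)\<^sup>2"
        by (intro eventually_mono[OF eventually_ge_at_top[of "nat \<lceil>\<bar>X \<omega>\<bar>\<rceil>"]]) (auto simp: clip_def)
    qed
  qed measurable
  with inf show False by simp
qed

text \<open>
  Here $B$ is arbitrary. In $|\varphi(h)|^2 = E[\cos hX]^2 + E[\sin hX]^2$ the sine term is at
  most $h^2 E[|X|]^2$, while $1 - E[\cos hX]$ exceeds $h^2/3$ times any clipped second moment
  of $X$ for small $h$, and the clipped second moments are unbounded.
\<close>

lemma (in prob_space) char_near_zero:
  fixes X :: "'a \<Rightarrow> real"
  assumes i1: "integrable M X" and inf: "\<not> integrable M (\<lambda>\<omega>. (X \<omega>)\<^sup>2)"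
  obtains h0 where "h0 > 0" "\<And>h. \<bar>h\<bar> \<le> h0 \<Longrightarrow> (cmod (char (distr M borel X) h))\<^sup>2 \<le> 1 - B * h\<^sup>2"
proof -
  have [measurable]: "X \<in> borel_measurable M" using i1 by simp
  define m where "m = expectation (\<lambda>\<omega>. \<bar>X \<omega>\<bar>)"
  have m: "m \<ge> 0" unfolding m_def by (rule Bochner_Integration.integral_nonneg) simp
  obtain L where L: "L > 0" and K: "3 * (B + m\<^sup>2) \<le> expectation (\<lambda>\<omega>. (clip L (X \<omega>))\<^sup>2)"
    using clipped_second_moment_unbounded[OF _ inf] by auto
  \<comment> \<open>The first bound makes the quadratic estimate of the cosine valid where |X| is at most L;
    the second keeps the expected cosine nonnegative, so that its square is at most itself.\<close>
  define h0 where "h0 = min (1 / L) (1 / (m + 1))"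
  have h0: "h0 > 0" using L m by (simp add: h0_def)
  show ?thesis
  proof (rule that[OF h0])
    fix h assume h: "\<bar>h\<bar> \<le> h0"
    define C where "C = expectation (\<lambda>\<omega>. cos (h * X \<omega>))"
    define S where "S = expectation (\<lambda>\<omega>. sin (h * X \<omega>))"
    have ic: "integrable M (\<lambda>\<omega>. cos (h * X \<omega>))" by (rule integrable_const_bound[of _ 1]) auto
    have isn: "integrable M (\<lambda>\<omega>. sin (h * X \<omega>))" by (rule integrable_const_bound[of _ 1]) auto
    have ie: "integrable M (\<lambda>\<omega>. iexp (h * X \<omega>))" by (rule integrable_const_bound[of _ 1]) auto
    have "char (distr M borel X) h = expectation (\<lambda>\<omega>. iexp (h * X \<omega>))"
      by (simp add: char_def integral_distr)
    moreover have "Re (expectation (\<lambda>\<omega>. iexp (h * X \<omega>))) = C"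
      unfolding C_def integral_Re[OF ie, symmetric] by (simp add: Re_exp)
    moreover have "Im (expectation (\<lambda>\<omega>. iexp (h * X \<omega>))) = S"
      unfolding S_def integral_Im[OF ie, symmetric] by (simp add: Im_exp)
    ultimately have phi: "(cmod (char (distr M borel X) h))\<^sup>2 = C\<^sup>2 + S\<^sup>2"
      by (simp add: cmod_power2)
    have "\<bar>S\<bar> \<le> expectation (\<lambda>\<omega>. \<bar>sin (h * X \<omega>)\<bar>)" unfolding S_def by (rule integral_abs_bound)
    also have "\<dots> \<le> expectation (\<lambda>\<omega>. \<bar>h\<bar> * \<bar>X \<omega>\<bar>)"
      using isn i1 abs_sin_x_le_abs_x by (intro integral_mono) (auto simp flip: abs_mult)
    also have "\<dots> = \<bar>h\<bar> * m" by (simp add: m_def)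
    finally have S: "S\<^sup>2 \<le> h\<^sup>2 * m\<^sup>2"
      using power_mono[of "\<bar>S\<bar>" "\<bar>h\<bar> * m" 2] by (simp add: power_mult_distrib)
    have C1: "1 - C = expectation (\<lambda>\<omega>. 1 - cos (h * X \<omega>))"
      unfolding C_def using ic by (simp add: prob_space)
    also have "\<dots> \<le> expectation (\<lambda>\<omega>. \<bar>h\<bar> * \<bar>X \<omega>\<bar>)"
      using ic i1 one_minus_cos_bounds(1) by (intro integral_mono) (auto simp flip: abs_mult)
    also have "\<dots> = \<bar>h\<bar> * m" by (simp add: m_def)
    also have "\<dots> \<le> (1 / (m + 1)) * (m + 1)"
      using h m by (intro mult_mono) (auto simp: h0_def)
    also have "\<dots> = 1" using m by simp
    finally have C0: "C \<ge> 0" by simp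
    have "h\<^sup>2 * (B + m\<^sup>2) \<le> h\<^sup>2 * (expectation (\<lambda>\<omega>. (clip L (X \<omega>))\<^sup>2) / 3)"
      using K by (intro mult_left_mono) auto
    also have "\<dots> = expectation (\<lambda>\<omega>. h\<^sup>2 / 3 * (clip L (X \<omega>))\<^sup>2)" by simp
    also have "\<dots> \<le> expectation (\<lambda>\<omega>. 1 - cos (h * X \<omega>))"
    proof (rule integral_mono_AE')
      show "integrable M (\<lambda>\<omega>. 1 - cos (h * X \<omega>))" using ic by auto
      show "AE \<omega> in M. h\<^sup>2 / 3 * (clip L (X \<omega>))\<^sup>2 \<le> 1 - cos (h * X \<omega>)"
      proof (rule AE_I2)
        fix \<omega>
        show "h\<^sup>2 / 3 * (clip L (X \<omega>))\<^sup>2 \<le> 1 - cos (h * X \<omega>)"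
        proof (cases "\<bar>X \<omega>\<bar> \<le> L")
          case True
          have "\<bar>h * X \<omega>\<bar> \<le> 1 / L * L"
            unfolding abs_mult using True h L by (intro mult_mono) (auto simp: h0_def)
          then have "\<bar>h * X \<omega>\<bar> \<le> 1" using L by simp
          from one_minus_cos_bounds(3)[OF this] True show ?thesis
            by (simp add: clip_def power_mult_distrib)
        qed (simp add: clip_def)
      qed
    qed simp
    also have "\<dots> = 1 - C" by (simp add: C1)
    finally have C: "C \<le> 1 - h\<^sup>2 * (B + m\<^sup>2)" by simp
    have "C \<le> 1" unfolding C_def using integral_mono[OF ic integrable_const[of 1]] by (simp add: prob_space)
    then have "C\<^sup>2 \<le> C" using C0 by (simp add: power2_eq_square mult_left_le)
    then show "(cmod (char (distr M borel X) h))\<^sup>2 \<le> 1 - B * h\<^sup>2"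
      unfolding phi using C S by (simp add: algebra_simps)
  qed
qed

context real_iid_sequence
begin

text \<open>
  The Gaussian limit $\exp(-\sigma^2 t^2/2)$ of the central limit theorem, in the degenerate case
  $\sigma = \infty$: by the previous lemma $|\varphi(t/\sqrt n)|^{2n} \le (1 - Bt^2/n)^n \le
  \exp(-Bt^2)$ for large $n$, with $B$ arbitrary.
\<close>

lemma scaled_char_limit:
  assumes i1: "integrable M (Y 1)" and inf: "\<not> integrable M (\<lambda>\<omega>. (Y 1 \<omega>)\<^sup>2)" and t: "t \<noteq> 0"
  shows "(\<lambda>n. (cmod (char (distr M borel (Y 1)) (t / sqrt (real n)))) ^ n) \<longlonglongrightarrow> 0"
proof (rule LIMSEQ_I)
  fix e :: real assume e: "e > 0"
  \<comment> \<open>With this choice exp(- B t^2) = exp(- 1 / e^2) < e^2, because exp x > x.\<close>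
  define B where "B = 1 / (e\<^sup>2 * t\<^sup>2)"
  have B: "B > 0" using e t by (simp add: B_def)
  obtain h0 where h0: "h0 > 0"
    and phi: "\<And>h. \<bar>h\<bar> \<le> h0 \<Longrightarrow> (cmod (char (distr M borel (Y 1)) h))\<^sup>2 \<le> 1 - B * h\<^sup>2"
    using char_near_zero[OF i1 inf, of B] by blast
  show "\<exists>no. \<forall>n\<ge>no. norm ((cmod (char (distr M borel (Y 1)) (t / sqrt (real n)))) ^ n - 0) < e"
  proof (intro exI allI impI)
    fix n assume n: "n \<ge> max 1 (nat \<lceil>(t / h0)\<^sup>2\<rceil>)"
    then have n1: "n \<ge> 1" and nh: "(t / h0)\<^sup>2 \<le> real n" by linarith+
    define h where "h = t / sqrt (real n)"
    define a where "a = cmod (char (distr M borel (Y 1)) h)"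
    have h2: "h\<^sup>2 = t\<^sup>2 / real n" by (simp add: h_def power_divide)
    have "h\<^sup>2 \<le> h0\<^sup>2" using nh n1 h0 by (simp add: h2 power_divide divide_simps mult.commute)
    then have "\<bar>h\<bar> \<le> h0" using h0 by (simp add: abs_le_square_iff[symmetric])
    from phi[OF this] have "a\<^sup>2 \<le> 1 - B * h\<^sup>2" by (simp add: a_def)
    also have "\<dots> \<le> exp (- (B * h\<^sup>2))" using exp_ge_add_one_self[of "- (B * h\<^sup>2)"] by simp
    finally have "(a\<^sup>2) ^ n \<le> exp (- (B * h\<^sup>2)) ^ n" by (rule power_mono) simp
    also have "\<dots> = exp (- (B * t\<^sup>2))"
      using n1 by (simp add: h2 flip: exp_of_nat_mult)
    also have "\<dots> = exp (- (1 / e\<^sup>2))" using t by (simp add: B_def)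
    also have "\<dots> < e\<^sup>2"
    proof -
      have "1 / e\<^sup>2 < exp (1 / e\<^sup>2)" using exp_ge_add_one_self[of "1 / e\<^sup>2"] by linarith
      then show ?thesis using e by (simp add: exp_minus divide_simps mult.commute)
    qed
    finally have "(a ^ n)\<^sup>2 < e\<^sup>2" by (simp add: power_mult[symmetric] mult.commute)
    then have "a ^ n < e" using e by (intro power2_less_imp_less[of "a ^ n" e]) auto
    then show "norm ((cmod (char (distr M borel (Y 1)) (t / sqrt (real n)))) ^ n - 0) < e"
      by (simp add: a_def h_def)
  qed
qed

lemma sum_char:
  "expectation (\<lambda>\<omega>. iexp (t * (\<Sum>j=1..n. Y j \<omega>))) = char (distr M borel (Y 1)) t ^ n"
proof -
  have "indep_vars (\<lambda>_. borel) Y {1..n}" by (rule indep_vars_subset[OF indep]) auto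
  from char_distr_sum[OF this, of t]
  have "char (distr M borel (\<lambda>\<omega>. \<Sum>j=1..n. Y j \<omega>)) t = (\<Prod>j=1..n. char (distr M borel (Y j)) t)" .
  also have "\<dots> = (\<Prod>j=1..n. char (distr M borel (Y 1)) t)"
  proof (intro prod.cong refl)
    fix j assume "j \<in> {1..n}"
    then have "distr M borel (Y j) = distr M borel (Y 1)" by (intro ident) simp
    then show "char (distr M borel (Y j)) t = char (distr M borel (Y 1)) t" by simp
  qed
  moreover have "(\<lambda>\<omega>. \<Sum>j=1..n. Y j \<omega>) \<in> borel_measurable M" by measurable
  ultimately show ?thesis by (simp add: char_def integral_distr)
qed

text \<open>
  Integrate $1 - \cos x \le x^2/2$ at $x = t \sqrt n\,(S_n - d)$ over $A$. The centre $d$ contributes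
  only a unimodular factor to the characteristic function, which is why the bound is uniform in $d$.
  Removing the complement of $A$ costs at most twice its probability.
\<close>

lemma mean_spread_lower_bound:
  assumes n: "n \<ge> 1" and t: "t \<noteq> 0" and A [measurable]: "A \<in> sets M"
    and int: "integrable M (\<lambda>\<omega>. indicator A \<omega> * (sample_mean Y n \<omega> - d)\<^sup>2)"
  shows "2 / t\<^sup>2 * (1 - (cmod (char (distr M borel (Y 1)) (t / sqrt (real n)))) ^ n - 2 * prob (space M - A))
    \<le> real n * expectation (\<lambda>\<omega>. indicator A \<omega> * (sample_mean Y n \<omega> - d)\<^sup>2)"
proof -
  define s where "s = t * sqrt (real n)"
  have ts: "s * sample_mean Y n \<omega> = t / sqrt (real n) * (\<Sum>j=1..n. Y j \<omega>)" for \<omega>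
  proof -
    have "t / sqrt (real n) = s / real n"
      using n by (simp add: s_def divide_simps)
    then show ?thesis by (simp add: sample_mean_def)
  qed
  have ie: "integrable M (\<lambda>\<omega>. iexp (s * (sample_mean Y n \<omega> - d)))"
    by (rule integrable_const_bound[of _ 1]) auto
  have ic: "integrable M (\<lambda>\<omega>. cos (s * (sample_mean Y n \<omega> - d)))"
    by (rule integrable_const_bound[of _ 1]) auto
  have "expectation (\<lambda>\<omega>. iexp (s * (sample_mean Y n \<omega> - d)))
      = expectation (\<lambda>\<omega>. iexp (- (s * d)) * iexp (t / sqrt (real n) * (\<Sum>j=1..n. Y j \<omega>)))"
    unfolding ts[symmetric] by (simp add: algebra_simps flip: exp_add)
  also have "\<dots> = iexp (- (s * d)) * char (distr M borel (Y 1)) (t / sqrt (real n)) ^ n"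
    unfolding sum_char[symmetric] by simp
  finally have "cmod (expectation (\<lambda>\<omega>. iexp (s * (sample_mean Y n \<omega> - d))))
      = cmod (char (distr M borel (Y 1)) (t / sqrt (real n))) ^ n"
    by (simp add: norm_mult norm_power)
  moreover have "expectation (\<lambda>\<omega>. cos (s * (sample_mean Y n \<omega> - d)))
      = Re (expectation (\<lambda>\<omega>. iexp (s * (sample_mean Y n \<omega> - d))))"
    unfolding integral_Re[OF ie, symmetric] by (simp add: Re_exp)
  ultimately have cos_le: "expectation (\<lambda>\<omega>. cos (s * (sample_mean Y n \<omega> - d)))
      \<le> cmod (char (distr M borel (Y 1)) (t / sqrt (real n))) ^ n"
    using complex_Re_le_cmod by metis
  have iA: "integrable M (\<lambda>\<omega>. 2 * indicator (space M - A) \<omega> :: real)" by (simp add: less_top[symmetric])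
  have "1 - expectation (\<lambda>\<omega>. cos (s * (sample_mean Y n \<omega> - d))) - 2 * prob (space M - A)
      = expectation (\<lambda>\<omega>. 1 - cos (s * (sample_mean Y n \<omega> - d)) - 2 * indicator (space M - A) \<omega>)"
    using ic iA by (simp add: prob_space)
  also have "\<dots> \<le> expectation (\<lambda>\<omega>. s\<^sup>2 / 2 * (indicator A \<omega> * (sample_mean Y n \<omega> - d)\<^sup>2))"
  proof (rule integral_mono)
    fix \<omega> assume \<omega>: "\<omega> \<in> space M"
    show "1 - cos (s * (sample_mean Y n \<omega> - d)) - 2 * indicator (space M - A) \<omega>
        \<le> s\<^sup>2 / 2 * (indicator A \<omega> * (sample_mean Y n \<omega> - d)\<^sup>2)"
    proof (cases "\<omega> \<in> A")
      case True
      then show ?thesis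
        using one_minus_cos_bounds(2)[of "s * (sample_mean Y n \<omega> - d)"] by (simp add: power_mult_distrib)
    next
      case False
      then show ?thesis using \<omega> cos_ge_minus_one[of "s * (sample_mean Y n \<omega> - d)"] by simp
    qed
  qed (use ic iA int in auto)
  also have "\<dots> = t\<^sup>2 / 2 * (real n * expectation (\<lambda>\<omega>. indicator A \<omega> * (sample_mean Y n \<omega> - d)\<^sup>2))"
    by (simp add: s_def power_mult_distrib)
  finally have "1 - (cmod (char (distr M borel (Y 1)) (t / sqrt (real n)))) ^ n - 2 * prob (space M - A)
      \<le> t\<^sup>2 / 2 * (real n * expectation (\<lambda>\<omega>. indicator A \<omega> * (sample_mean Y n \<omega> - d)\<^sup>2))"
    using cos_le by linarith
  then have "2 / t\<^sup>2 * (1 - (cmod (char (distr M borel (Y 1)) (t / sqrt (real n)))) ^ n - 2 * prob (space M - A))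
      \<le> 2 / t\<^sup>2 * (t\<^sup>2 / 2 * (real n * expectation (\<lambda>\<omega>. indicator A \<omega> * (sample_mean Y n \<omega> - d)\<^sup>2)))"
    by (rule mult_left_mono) simp
  then show ?thesis using t by simp
qed

end

section \<open>The delta method under an infinite second moment\<close>

text \<open>
  Near $\mu$ the map $w \mapsto g(w) - g'(\mu) w$ has derivative of modulus at most
  $|g'(\mu)|/2$, so the mean value inequality bounds its increments by half of those of the
  linear part.
\<close>

lemma locally_expanding:
  fixes g :: "complex \<Rightarrow> complex"
  assumes d0: "d0 > 0" and D: "\<And>w. w \<in> ball \<mu> d0 \<Longrightarrow> (g has_field_derivative g' w) (at w)"
    and cont: "isCont g' \<mu>" and nz: "g' \<mu> \<noteq> 0"
  obtains \<delta> where "\<delta> > 0" "\<delta> < d0"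
    "\<And>w z. w \<in> cball \<mu> \<delta> \<Longrightarrow> z \<in> cball \<mu> \<delta> \<Longrightarrow> cmod (g' \<mu>) / 2 * cmod (w - z) \<le> cmod (g w - g z)"
proof -
  obtain d1 where d1: "d1 > 0" and near: "\<And>w. cmod (w - \<mu>) < d1 \<Longrightarrow> cmod (g' w - g' \<mu>) < cmod (g' \<mu>) / 2"
    using cont nz unfolding continuous_at_eps_delta dist_norm
    by (metis half_gt_zero zero_less_norm_iff)
  define \<delta> where "\<delta> = min d0 d1 / 2"
  have \<delta>: "\<delta> > 0" "\<delta> < d0" "\<delta> < d1" using d0 d1 by (auto simp: \<delta>_def)
  show ?thesis
  proof (rule that[OF \<delta>(1,2)])
    fix w z assume wz: "w \<in> cball \<mu> \<delta>" "z \<in> cball \<mu> \<delta>"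
    have "norm ((g w - g' \<mu> * w) - (g z - g' \<mu> * z)) \<le> cmod (g' \<mu>) / 2 * norm (w - z)"
    proof (rule field_differentiable_bound[of "cball \<mu> \<delta>" _ "\<lambda>x. g' x - g' \<mu>"])
      fix x assume x: "x \<in> cball \<mu> \<delta>"
      then show "((\<lambda>w. g w - g' \<mu> * w) has_field_derivative g' x - g' \<mu>) (at x within cball \<mu> \<delta>)"
        using \<delta> by (auto intro!: derivative_eq_intros has_field_derivative_at_within[OF D])
      have "cmod (x - \<mu>) < d1" using x \<delta> by (simp add: dist_norm norm_minus_commute)
      from near[OF this] show "norm (g' x - g' \<mu>) \<le> cmod (g' \<mu>) / 2" by simp
    qed (use wz in auto)
    moreover have "(g w - g' \<mu> * w) - (g z - g' \<mu> * z) = (g w - g z) - g' \<mu> * (w - z)"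
      by (simp add: algebra_simps)
    moreover have "cmod (g' \<mu>) * cmod (w - z) - cmod (g w - g z) \<le> cmod ((g w - g z) - g' \<mu> * (w - z))"
      using norm_triangle_ineq2[of "g' \<mu> * (w - z)" "g w - g z"] by (simp add: norm_mult norm_minus_commute)
    ultimately show "cmod (g' \<mu>) / 2 * cmod (w - z) \<le> cmod (g w - g z)" by simp
  qed
qed

context complex_iid_sequence
begin

text \<open>
  Let $c = E[g(S_n)]$. It need not be a value of $g$ near $\mu$; instead take $z$ in the closed
  disc around $\mu$ with $g(z)$ closest to $c$. For $S_n$ in the disc,
  $|g(S_n) - g(z)| \le 2 |g(S_n) - c|$, so the local expansion of $g$ compares
  $|g(S_n) - c|$ with $|S_n - z|$, and thus with the distance of a real mean from the
  real number $\mathrm{Re}(uz)$, whose spread has been bounded uniformly in the centre.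
\<close>

theorem infinite_variance_delta_method:
  fixes g :: "complex \<Rightarrow> complex"
  assumes i1: "integrable M (Y 1)"
    and u: "cmod u = 1" and inf: "\<not> integrable M (\<lambda>\<omega>. (Re (u * Y 1 \<omega>))\<^sup>2)"
    and g [measurable]: "g \<in> borel_measurable borel"
    and sq: "\<forall>\<^sub>F n in sequentially. integrable M (\<lambda>\<omega>. (cmod (g (sample_mean Y n \<omega>)))\<^sup>2)"
    and d0: "d0 > 0" and D: "\<And>w. w \<in> ball (expectation (Y 1)) d0 \<Longrightarrow> (g has_field_derivative g' w) (at w)"
    and cont: "isCont g' (expectation (Y 1))" and nz: "g' (expectation (Y 1)) \<noteq> 0"
  shows "filterlim (\<lambda>n. real n * cvariance M (\<lambda>\<omega>. g (sample_mean Y n \<omega>))) at_top sequentially"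
proof -
  interpret W: real_iid_sequence M "\<lambda>j \<omega>. Re (u * Y j \<omega>)"
    by (rule real_iid_image) simp
  define \<mu> where "\<mu> = expectation (Y 1)"
  obtain \<delta> where \<delta>: "\<delta> > 0" "\<delta> < d0" and exp0:
    "\<And>w z. w \<in> cball \<mu> \<delta> \<Longrightarrow> z \<in> cball \<mu> \<delta> \<Longrightarrow> cmod (g' \<mu>) / 2 * cmod (w - z) \<le> cmod (g w - g z)"
    using locally_expanding[OF d0 D cont nz] unfolding \<mu>_def by blast
  \<comment> \<open>One factor 1/2 comes from the local expansion, the other from replacing c by g z.\<close>
  define l where "l = cmod (g' \<mu>) / 4"
  have l: "l > 0" using nz by (simp add: l_def \<mu>_def)
  have cg: "continuous_on (cball \<mu> \<delta>) g"
  proof (intro continuous_at_imp_continuous_on ballI)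
    fix w assume "w \<in> cball \<mu> \<delta>"
    then show "isCont g w" using \<delta> by (intro DERIV_isCont[OF D]) (simp add: \<mu>_def)
  qed
  have iW: "integrable M (\<lambda>\<omega>. Re (u * Y 1 \<omega>))" using i1 by (intro integrable_Re integrable_mult_right)
  define A where "A n = {\<omega>\<in>space M. cmod (sample_mean Y n \<omega> - \<mu>) \<le> \<delta>}" for n
  have A [measurable]: "A n \<in> sets M" for n unfolding A_def by measurable
  have Ac: "(\<lambda>n. prob (space M - A n)) \<longlonglongrightarrow> 0"
  proof -
    have "space M - A n = {\<omega>\<in>space M. \<delta> < cmod (sample_mean Y n \<omega> - expectation (Y 1))}" for n
      by (auto simp: A_def \<mu>_def)
    then show ?thesis using complex_weak_law[OF i1 \<delta>(1)] by simp
  qed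
  define \<phi> where "\<phi> = char (distr M borel (\<lambda>\<omega>. Re (u * Y 1 \<omega>)))"
  have main: "l\<^sup>2 * (2 / t\<^sup>2 * (1 - cmod (\<phi> (t / sqrt (real n))) ^ n - 2 * prob (space M - A n)))
      \<le> real n * cvariance M (\<lambda>\<omega>. g (sample_mean Y n \<omega>))"
    if n: "n \<ge> 1" and sqn: "integrable M (\<lambda>\<omega>. (cmod (g (sample_mean Y n \<omega>)))\<^sup>2)" and t: "t \<noteq> 0" for n t
  proof -
    define c where "c = expectation (\<lambda>\<omega>. g (sample_mean Y n \<omega>))"
    have "continuous_on (cball \<mu> \<delta>) (\<lambda>z. cmod (g z - c))"
      using cg by (intro continuous_intros)
    then obtain z where z: "z \<in> cball \<mu> \<delta>" and zmin: "\<And>w. w \<in> cball \<mu> \<delta> \<Longrightarrow> cmod (g z - c) \<le> cmod (g w - c)"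
      using continuous_attains_inf[of "cball \<mu> \<delta>" "\<lambda>z. cmod (g z - c)"] \<delta> by auto
    define d where "d = Re (u * z)"
    let ?m = "sample_mean (\<lambda>j \<omega>. Re (u * Y j \<omega>)) n"
    have lin: "\<bar>?m \<omega> - d\<bar> \<le> cmod (sample_mean Y n \<omega> - z)" for \<omega>
    proof -
      have "?m \<omega> - d = Re (u * (sample_mean Y n \<omega> - z))"
        unfolding sample_mean_Re_mult d_def right_diff_distrib minus_complex.sel(1) ..
      then show ?thesis using abs_Re_le_cmod[of "u * (sample_mean Y n \<omega> - z)"] u by (simp only: norm_mult mult_1)
    qed
    have pw: "l\<^sup>2 * (indicator (A n) \<omega> * (?m \<omega> - d)\<^sup>2) \<le> (cmod (g (sample_mean Y n \<omega>) - c))\<^sup>2" for \<omega>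
    proof (cases "\<omega> \<in> A n")
      case True
      then have S: "sample_mean Y n \<omega> \<in> cball \<mu> \<delta>" by (simp add: A_def dist_norm norm_minus_commute)
      have "l * \<bar>?m \<omega> - d\<bar> \<le> l * cmod (sample_mean Y n \<omega> - z)"
        using lin l by (intro mult_left_mono) auto
      also have "\<dots> \<le> cmod (g (sample_mean Y n \<omega>) - g z) / 2"
        using exp0[OF S z] by (simp add: l_def)
      also have "cmod (g (sample_mean Y n \<omega>) - g z) \<le> cmod (g (sample_mean Y n \<omega>) - c) + cmod (g z - c)"
        using norm_triangle_ineq4[of "g (sample_mean Y n \<omega>) - c" "g z - c"] by simp
      also have "\<dots> \<le> 2 * cmod (g (sample_mean Y n \<omega>) - c)" using zmin[OF S] by simp
      finally have "l * \<bar>?m \<omega> - d\<bar> \<le> cmod (g (sample_mean Y n \<omega>) - c)" by simp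
      then have "(l * \<bar>?m \<omega> - d\<bar>)\<^sup>2 \<le> (cmod (g (sample_mean Y n \<omega>) - c))\<^sup>2"
        using l by (intro power_mono) auto
      then show ?thesis using True by (simp add: power_mult_distrib)
    qed simp
    have iv: "integrable M (\<lambda>\<omega>. (cmod (g (sample_mean Y n \<omega>) - c))\<^sup>2)"
      by (rule integrable_centered_sq[OF _ sqn]) measurable
    have il: "integrable M (\<lambda>\<omega>. l\<^sup>2 * (indicator (A n) \<omega> * (?m \<omega> - d)\<^sup>2))"
    proof (rule Bochner_Integration.integrable_bound[OF iv])
      show "AE \<omega> in M. norm (l\<^sup>2 * (indicator (A n) \<omega> * (?m \<omega> - d)\<^sup>2))
          \<le> norm ((cmod (g (sample_mean Y n \<omega>) - c))\<^sup>2)"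
        using pw by (intro AE_I2) simp
    qed measurable
    have im: "integrable M (\<lambda>\<omega>. indicator (A n) \<omega> * (?m \<omega> - d)\<^sup>2)"
      using integrable_mult_right[OF il, of "1 / l\<^sup>2"] l by simp
    have "l\<^sup>2 * (2 / t\<^sup>2 * (1 - cmod (\<phi> (t / sqrt (real n))) ^ n - 2 * prob (space M - A n)))
        \<le> l\<^sup>2 * (real n * expectation (\<lambda>\<omega>. indicator (A n) \<omega> * (?m \<omega> - d)\<^sup>2))"
      unfolding \<phi>_def by (intro mult_left_mono W.mean_spread_lower_bound[OF n t A im]) simp
    also have "\<dots> = real n * expectation (\<lambda>\<omega>. l\<^sup>2 * (indicator (A n) \<omega> * (?m \<omega> - d)\<^sup>2))"
      by simp
    also have "\<dots> \<le> real n * expectation (\<lambda>\<omega>. (cmod (g (sample_mean Y n \<omega>) - c))\<^sup>2)"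
      by (intro mult_left_mono integral_mono il iv pw) simp
    finally show ?thesis by (simp add: cvariance_def c_def)
  qed
  show ?thesis
    unfolding filterlim_at_top
  proof
    fix Z0 :: real
    define Z where "Z = max Z0 1"
    \<comment> \<open>The bound below tends to 2 l^2 / t^2 = 2 Z, hence eventually exceeds Z.\<close>
    define t where "t = l / sqrt Z"
    have t: "t \<noteq> 0" using l by (simp add: t_def Z_def)
    have "(\<lambda>n. 1 - cmod (\<phi> (t / sqrt (real n))) ^ n - 2 * prob (space M - A n)) \<longlonglongrightarrow> 1 - 0 - 2 * 0"
      unfolding \<phi>_def by (intro tendsto_intros W.scaled_char_limit[OF iW inf t] Ac)
    then have "\<forall>\<^sub>F n in sequentially. 1 / 2 < 1 - cmod (\<phi> (t / sqrt (real n))) ^ n - 2 * prob (space M - A n)"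
      by (intro order_tendstoD(1)) auto
    with sq eventually_ge_at_top[of 1]
    show "\<forall>\<^sub>F n in sequentially. Z0 \<le> real n * cvariance M (\<lambda>\<omega>. g (sample_mean Y n \<omega>))"
    proof eventually_elim
      case (elim n)
      have "Z0 \<le> Z" by (simp add: Z_def)
      also have "Z = l\<^sup>2 * (2 / t\<^sup>2 * (1 / 2))"
        using l by (simp add: t_def power_divide Z_def)
      also have "\<dots> \<le> l\<^sup>2 * (2 / t\<^sup>2 * (1 - cmod (\<phi> (t / sqrt (real n))) ^ n - 2 * prob (space M - A n)))"
        using elim(3) by (intro mult_left_mono) auto
      also have "\<dots> \<le> real n * cvariance M (\<lambda>\<omega>. g (sample_mean Y n \<omega>))"
        by (rule main) (use elim t in auto)
      finally show ?case .
    qed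
  qed
qed

end

section \<open>Powers on the closed upper half-plane\<close>

text \<open>
  The argument of $z^p$ lies in $[p\pi, 0]$, an interval of length less than $\pi$; rotating
  its midpoint $p\pi/2$ to $0$ leaves arguments of modulus at most $|p|\pi/2 < \pi/2$.
\<close>

lemma upper_half_plane_power_in_cone:
  assumes p: "-1 < p" "p < 0" and z: "Im z \<ge> 0" "z \<noteq> 0"
  shows "cos (p * pi / 2) * cmod z powr p \<le> Re (cis (- (p * pi / 2)) * z powr of_real p)"
proof -
  define \<theta> where "\<theta> = Im (Ln z)"
  have \<theta>: "0 \<le> \<theta>" "\<theta> \<le> pi" using Im_Ln_pos_le[OF z(2)] z(1) by (auto simp: \<theta>_def)
  have "z powr of_real p = exp (of_real p * Ln z)"
    using z(2) by (simp add: powr_def)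
  also have "\<dots> = of_real (cmod z powr p) * cis (p * \<theta>)"
    using z(2) by (simp add: exp_eq_polar powr_def \<theta>_def)
  finally have "z powr of_real p = of_real (cmod z powr p) * cis (p * \<theta>)" .
  then have "Re (cis (- (p * pi / 2)) * z powr of_real p) = cmod z powr p * Re (cis (- (p * pi / 2)) * cis (p * \<theta>))"
    by (simp add: algebra_simps)
  also have "cis (- (p * pi / 2)) * cis (p * \<theta>) = cis (p * (\<theta> - pi / 2))"
    by (simp add: cis_mult algebra_simps)
  also have "Re (cis (p * (\<theta> - pi / 2))) = cos \<bar>p * (\<theta> - pi / 2)\<bar>" by simp
  finally have eq: "Re (cis (- (p * pi / 2)) * z powr of_real p) = cmod z powr p * cos \<bar>p * (\<theta> - pi / 2)\<bar>" .
  have "cos \<bar>p * pi / 2\<bar> \<le> cos \<bar>p * (\<theta> - pi / 2)\<bar>"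
  proof (rule cos_monotone_0_pi_le)
    have "\<bar>p\<bar> * \<bar>\<theta> - pi / 2\<bar> \<le> \<bar>p\<bar> * (pi / 2)"
      using \<theta> by (intro mult_left_mono) linarith+
    then show "\<bar>p * (\<theta> - pi / 2)\<bar> \<le> \<bar>p * pi / 2\<bar>" by (simp add: abs_mult)
    have "\<bar>p\<bar> * (pi / 2) \<le> 1 * pi" using p by (intro mult_mono) auto
    then show "\<bar>p * pi / 2\<bar> \<le> pi" by (simp add: abs_mult)
  qed simp
  then have "cos (p * pi / 2) \<le> cos \<bar>p * (\<theta> - pi / 2)\<bar>" by (simp only: cos_abs_real)
  then show ?thesis unfolding eq by (subst mult.commute) (intro mult_left_mono, auto)
qed

text \<open>
  For $p > -1$ the values lie in a proper cone, so the real part is comparable with the modulus and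
  $a = -p$. For $p = -1$ they lie only in the lower half-plane, and
  $-\mathrm{Im}(1/z) = \mathrm{Im}(z)/|z|^2$ gives $a = 2$; here $\mathrm{Im}\,\alpha > 0$
  is essential. Together with a positive real part of $u E[Y]$, the sign condition on
  $\mathrm{Re}\,u$ will keep $E[Y]$ off the branch cut of the powers.
\<close>

lemma pow_gen_in_half_plane:
  assumes p: "-1 \<le> p" "p < 0" and \<alpha>: "Im \<alpha> \<ge> 0" "p = -1 \<Longrightarrow> Im \<alpha> > 0"
  obtains u \<kappa> a where "cmod u = 1" "Re u \<ge> 0" "\<kappa> > 0" "a > 0" "-1 < p \<Longrightarrow> a = - p"
    "\<And>x::real. of_real x + \<alpha> \<noteq> 0 \<Longrightarrow> \<kappa> * cmod (of_real x + \<alpha>) powr (- a) \<le> Re (u * pow_gen p \<alpha> (of_real x))"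
proof (cases "p = -1")
  case True
  show ?thesis
  proof (rule that[of \<i> "Im \<alpha>" 2])
    fix x :: real assume nz: "of_real x + \<alpha> \<noteq> 0"
    define z where "z = of_real x + \<alpha>"
    have "pow_gen p \<alpha> (of_real x) = inverse z"
      using nz by (simp add: pow_gen_def True z_def powr_minus)
    then have "Re (\<i> * pow_gen p \<alpha> (of_real x)) = Im z / (cmod z)\<^sup>2"
      by (simp add: cmod_power2)
    moreover have "cmod z powr (- 2) = 1 / (cmod z)\<^sup>2"
      using nz by (simp add: powr_minus z_def divide_inverse)
    ultimately show "Im \<alpha> * cmod (of_real x + \<alpha>) powr (- 2) \<le> Re (\<i> * pow_gen p \<alpha> (of_real x))"
      by (simp add: z_def)
  qed (use True \<alpha> in auto)
next
  case False
  show ?thesis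
  proof (rule that[of "cis (- (p * pi / 2))" "cos (p * pi / 2)" "- p"])
    have "\<bar>p\<bar> * (pi / 2) < 1 * (pi / 2)"
      using p False by (intro mult_strict_right_mono) auto
    then have "\<bar>p * pi / 2\<bar> < pi / 2" by (simp add: abs_mult)
    then show c: "cos (p * pi / 2) > 0" by (intro cos_gt_zero_pi) linarith+
    then show "Re (cis (- (p * pi / 2))) \<ge> 0" by simp
    fix x :: real assume nz: "of_real x + \<alpha> \<noteq> 0"
    then show "cos (p * pi / 2) * cmod (of_real x + \<alpha>) powr (- (- p)) \<le> Re (cis (- (p * pi / 2)) * pow_gen p \<alpha> (of_real x))"
      using upper_half_plane_power_in_cone[of p "of_real x + \<alpha>"] p False \<alpha>
      by (simp add: pow_gen_def del: times_complex.sel)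
  qed (use p in auto)
qed

lemma measurable_complex_powr [measurable]: "(\<lambda>z::complex. z powr c) \<in> borel_measurable borel"
  unfolding powr_def by measurable

lemma cmod_pow_gen: "cmod (pow_gen p \<alpha> z) = cmod (z + \<alpha>) powr p"
  by (simp add: pow_gen_def norm_powr_real_powr')

lemma cmod_powr_sq: "(cmod (w powr of_real q))\<^sup>2 = cmod w powr (2 * q)"
  by (simp add: norm_powr_real_powr' power2_eq_square flip: powr_add)

text \<open>
  The derivative of the inverse function is the reciprocal of the derivative. Only moduli are
  compared, so no branch of the argument of $w$ has to be tracked.
\<close>

lemma pow_gen_deriv_inverse:
  assumes "p \<noteq> 0" "w \<noteq> 0"
  shows "cmod (of_real (1 / p) * w powr (of_real (1 / p) - 1)) = 1 / cmod (pow_gen_deriv p \<alpha> (pow_gen_inv p \<alpha> w))"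
proof -
  define q where "q = 1 / p - 1"
  have "cmod (pow_gen_deriv p \<alpha> (pow_gen_inv p \<alpha> w)) = \<bar>p\<bar> * (cmod w powr (1 / p)) powr (p - 1)"
    unfolding pow_gen_deriv_def pow_gen_inv_def norm_mult by (simp add: norm_powr_real_powr')
  also have "(cmod w powr (1 / p)) powr (p - 1) = cmod w powr (- q)"
    using assms by (simp add: powr_powr diff_divide_distrib q_def)
  finally have "1 / cmod (pow_gen_deriv p \<alpha> (pow_gen_inv p \<alpha> w)) = 1 / \<bar>p\<bar> * cmod w powr q"
    by (simp add: powr_minus divide_inverse)
  moreover have "of_real (1 / p) - 1 = (of_real q :: complex)" by (simp add: q_def)
  ultimately show ?thesis
    by (simp only: norm_mult norm_of_real abs_divide abs_one) (simp add: norm_powr_real_powr')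
qed

lemma (in prob_space) integrable_shifted_powr:
  fixes X :: "'a \<Rightarrow> real"
  assumes [measurable]: "X \<in> borel_measurable M" and s: "s > 0"
    and int: "integrable M (\<lambda>\<omega>. \<bar>X \<omega>\<bar> powr s)"
  shows "integrable M (\<lambda>\<omega>. cmod (of_real (X \<omega>) + \<alpha>) powr s)"
proof (rule Bochner_Integration.integrable_bound)
  show "integrable M (\<lambda>\<omega>. 2 powr s * (\<bar>X \<omega>\<bar> powr s + cmod \<alpha> powr s))" using int by auto
  show "AE \<omega> in M. norm (cmod (of_real (X \<omega>) + \<alpha>) powr s) \<le> norm (2 powr s * (\<bar>X \<omega>\<bar> powr s + cmod \<alpha> powr s))"
  proof (rule AE_I2)
    fix \<omega>
    have "cmod (of_real (X \<omega>) + \<alpha>) \<le> \<bar>X \<omega>\<bar> + cmod \<alpha>"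
      using norm_triangle_ineq[of "of_real (X \<omega>) :: complex" \<alpha>] by simp
    then have "cmod (of_real (X \<omega>) + \<alpha>) \<le> 2 * max \<bar>X \<omega>\<bar> (cmod \<alpha>)" by linarith
    then have "cmod (of_real (X \<omega>) + \<alpha>) powr s \<le> (2 * max \<bar>X \<omega>\<bar> (cmod \<alpha>)) powr s"
      using s by (intro powr_mono2) auto
    also have "\<dots> = 2 powr s * max \<bar>X \<omega>\<bar> (cmod \<alpha>) powr s" by (simp add: powr_mult)
    also have "\<dots> \<le> 2 powr s * (\<bar>X \<omega>\<bar> powr s + cmod \<alpha> powr s)"
      by (intro mult_left_mono) (auto simp: max_def)
    finally show "norm (cmod (of_real (X \<omega>) + \<alpha>) powr s) \<le> norm (2 powr s * (\<bar>X \<omega>\<bar> powr s + cmod \<alpha> powr s))"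
      by simp
  qed
qed measurable

theorem theorem4p2:
  fixes M :: "'a measure" and X :: "nat \<Rightarrow> 'a \<Rightarrow> real" and p :: real and \<alpha> :: complex
  defines "fX \<equiv> (\<lambda>\<omega>. pow_gen p \<alpha> (complex_of_real (X 1 \<omega>)))"
  assumes "prob_space M"
    and "prob_space.indep_vars M (\<lambda>_. borel) X {1..}"
    and "\<And>j. j \<ge> 1 \<Longrightarrow> distr M borel (X j) = distr M borel (X 1)"
    and "\<And>x. measure M {\<omega> \<in> space M. X 1 \<omega> = x} = 0"
    and "in_L0plus M (X 1)"
    and "- 1 \<le> p" and "p < 0" and "Im \<alpha> \<ge> 0"
  shows
    "(Im \<alpha> > 0 \<or> (- 1 < p \<and> \<alpha> \<in> \<real> \<and> in_Ls M 2 fX) \<longrightarrow>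
        (\<lambda>n. real n * cvariance M (pow_mean p \<alpha> X n)) \<longlonglongrightarrow>
          cvariance M fX
            / (cmod (pow_gen_deriv p \<alpha> (pow_gen_inv p \<alpha> (\<integral>\<omega>. fX \<omega> \<partial>M))))\<^sup>2)
     \<and> (- 1 < p \<and> \<alpha> \<in> \<real> \<and> in_Ls M 1 fX \<and> \<not> in_Ls M 2 fX \<longrightarrow>
        filterlim (\<lambda>n. real n * cvariance M (pow_mean p \<alpha> X n)) at_top sequentially)"
proof -
  interpret prob_space M by fact
  interpret X: iid_sequence M X by unfold_locales fact+
  define Y where "Y j \<omega> = pow_gen p \<alpha> (complex_of_real (X j \<omega>))" for j \<omega>
  have fX: "fX = Y 1" by (simp add: fX_def Y_def[abs_def])
  have "(\<lambda>x. pow_gen p \<alpha> (complex_of_real x)) \<in> borel_measurable borel"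
    unfolding pow_gen_def by measurable
  from X.iid_compose[OF this] interpret Y: complex_iid_sequence M Y
    unfolding Y_def[abs_def] complex_iid_sequence_def .
  define \<mu> where "\<mu> = expectation (Y 1)"
  define g where "g w = w powr complex_of_real (1 / p)" for w
  define g' where "g' w = complex_of_real (1 / p) * w powr (complex_of_real (1 / p) - 1)" for w
  have [measurable]: "g \<in> borel_measurable borel" unfolding g_def[abs_def] by measurable
  define k where "k = - (2 / p)"
  have k: "k \<ge> 0" using \<open>p < 0\<close> by (simp add: k_def)
  have gsq: "(cmod (g w))\<^sup>2 = cmod w powr (- k)" for w
    unfolding g_def cmod_powr_sq by (simp add: k_def)
  have mean: "pow_mean p \<alpha> X n = (\<lambda>\<omega>. g (sample_mean Y n \<omega>) + (- \<alpha>))" for n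
    by (simp add: fun_eq_iff pow_mean_def pow_gen_inv_def sample_mean_def g_def Y_def)

  show ?thesis
  proof (cases "p = -1 \<longrightarrow> Im \<alpha> > 0")
    case ok: True
    obtain u \<kappa> a where u: "cmod u = 1" "Re u \<ge> 0" and \<kappa>: "\<kappa> > 0" and a: "a > 0" "-1 < p \<Longrightarrow> a = - p"
      and half: "\<And>x::real. of_real x + \<alpha> \<noteq> 0 \<Longrightarrow> \<kappa> * cmod (of_real x + \<alpha>) powr (- a) \<le> Re (u * pow_gen p \<alpha> (of_real x))"
      using pow_gen_in_half_plane[of p \<alpha>] assms ok by blast
    \<comment> \<open>As the distribution has no atoms, the singularity of f is hit with probability zero.\<close>
    have nz: "AE \<omega> in M. of_real (X 1 \<omega>) + \<alpha> \<noteq> 0"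
    proof -
      have "AE \<omega> in M. X 1 \<omega> \<noteq> - Re \<alpha>"
        using assms(5)[of "- Re \<alpha>"] by (subst AE_iff_measurable[OF _ refl]) (auto simp: emeasure_eq_measure)
      then show ?thesis by eventually_elim (auto simp: complex_eq_iff)
    qed
    have low: "AE \<omega> in M. 0 < \<kappa> * cmod (of_real (X 1 \<omega>) + \<alpha>) powr (- a) \<and>
        \<kappa> * cmod (of_real (X 1 \<omega>) + \<alpha>) powr (- a) \<le> Re (u * Y 1 \<omega>)"
      using nz by eventually_elim (use half \<kappa> in \<open>auto simp: Y_def simp del: times_complex.sel\<close>)
    have pos: "AE \<omega> in M. Re (u * Y 1 \<omega>) > 0"
      using low by eventually_elim linarith
    obtain s where s: "s > 0" and Xs: "integrable M (\<lambda>\<omega>. \<bar>X 1 \<omega>\<bar> powr s)"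
      using assms(6) by (auto simp: in_L0plus_def in_Ls_def)
    define r where "r = s / a"
    have r: "r > 0" using s a by (simp add: r_def)
    have neg: "integrable M (\<lambda>\<omega>. Re (u * Y 1 \<omega>) powr (- r))"
    proof (rule Bochner_Integration.integrable_bound)
      show "integrable M (\<lambda>\<omega>. \<kappa> powr (- r) * cmod (of_real (X 1 \<omega>) + \<alpha>) powr s)"
        using integrable_shifted_powr[OF _ s Xs] by auto
      show "AE \<omega> in M. norm (Re (u * Y 1 \<omega>) powr (- r)) \<le> norm (\<kappa> powr (- r) * cmod (of_real (X 1 \<omega>) + \<alpha>) powr s)"
        using low
      proof eventually_elim
        case (elim \<omega>)
        have "Re (u * Y 1 \<omega>) powr (- r) \<le> (\<kappa> * cmod (of_real (X 1 \<omega>) + \<alpha>) powr (- a)) powr (- r)"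
          using elim r by (intro powr_mono2') auto
        also have "\<dots> = \<kappa> powr (- r) * cmod (of_real (X 1 \<omega>) + \<alpha>) powr s"
          using \<kappa> a by (simp add: powr_mult powr_powr r_def)
        finally show ?case by (simp del: times_complex.sel)
      qed
    qed measurable
    have ev: "\<forall>\<^sub>F n in sequentially. integrable M (\<lambda>\<omega>. (cmod (g (sample_mean Y n \<omega>)))\<^sup>2)"
      unfolding gsq by (rule Y.eventually_integrable_mean_powr[OF u(1) pos r neg k])
    then have shift: "\<forall>\<^sub>F n in sequentially. real n * cvariance M (\<lambda>\<omega>. g (sample_mean Y n \<omega>))
        = real n * cvariance M (pow_mean p \<alpha> X n)"
    proof eventually_elim
      case (elim n)
      have "integrable M (\<lambda>\<omega>. g (sample_mean Y n \<omega>))"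
        by (rule sq_integrable_imp_integrable_complex[OF _ elim]) measurable
      then show ?case unfolding mean by (simp only: cvariance_add_const)
    qed
    \<comment> \<open>On the branch cut Re (u * w) is nonpositive because Re u is nonnegative; Re (u * \<mu>) is positive.\<close>
    have \<mu>_out: "\<mu> \<notin> \<real>\<^sub>\<le>\<^sub>0" if i1: "integrable M (Y 1)"
    proof
      assume "\<mu> \<in> \<real>\<^sub>\<le>\<^sub>0"
      then have "Re (u * \<mu>) \<le> 0"
        using u by (auto simp: complex_nonpos_Reals_iff mult_nonneg_nonpos)
      moreover have "Re (u * \<mu>) = expectation (\<lambda>\<omega>. Re (u * Y 1 \<omega>))"
        using i1 unfolding \<mu>_def by (subst integral_Re) (auto simp del: times_complex.sel)
      moreover have "expectation (\<lambda>\<omega>. Re (u * Y 1 \<omega>)) > 0"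
        by (rule expectation_greater) (use i1 pos in \<open>auto simp del: times_complex.sel\<close>)
      ultimately show False by linarith
    qed
    have Dg: "(g has_field_derivative g' w) (at w)" if "w \<notin> \<real>\<^sub>\<le>\<^sub>0" for w
      unfolding g_def[abs_def] g'_def using that by (rule has_field_derivative_powr)
    show ?thesis
    proof (intro conjI impI)
      assume A: "Im \<alpha> > 0 \<or> (- 1 < p \<and> \<alpha> \<in> \<real> \<and> in_Ls M 2 fX)"
      have sq: "integrable M (\<lambda>\<omega>. (cmod (Y 1 \<omega>))\<^sup>2)"
      proof (cases "Im \<alpha> > 0")
        case True
        show ?thesis
        proof (rule integrable_const_bound[of _ "(Im \<alpha> powr p)\<^sup>2"])
          have "Im \<alpha> \<le> cmod (of_real (X 1 \<omega>) + \<alpha>)" for \<omega>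
            using abs_Im_le_cmod[of "of_real (X 1 \<omega>) + \<alpha>"] by simp
          then show "AE \<omega> in M. norm ((cmod (Y 1 \<omega>))\<^sup>2) \<le> (Im \<alpha> powr p)\<^sup>2"
            unfolding Y_def cmod_pow_gen using True \<open>p < 0\<close>
            by (intro AE_I2) (auto intro!: power_mono powr_mono2')
        qed measurable
      next
        case False
        then show ?thesis using A by (simp add: in_Ls_def fX)
      qed
      have out: "\<mu> \<notin> \<real>\<^sub>\<le>\<^sub>0" by (rule \<mu>_out[OF Y.sq_parts(1)[OF sq]])
      then have "\<mu> \<noteq> 0" by auto
      have "(\<lambda>n. real n * cvariance M (\<lambda>\<omega>. g (sample_mean Y n \<omega>))) \<longlonglongrightarrow> (cmod (g' \<mu>))\<^sup>2 * cvariance M (Y 1)"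
        by (rule Y.delta_method_cvariance[OF sq u(1) pos r neg _ _ _ k])
          (use Dg[OF out] gsq in \<open>auto simp: \<mu>_def\<close>)
      moreover have "(cmod (g' \<mu>))\<^sup>2 * cvariance M (Y 1) = cvariance M fX
            / (cmod (pow_gen_deriv p \<alpha> (pow_gen_inv p \<alpha> (\<integral>\<omega>. fX \<omega> \<partial>M))))\<^sup>2"
        using pow_gen_deriv_inverse[of p \<mu> \<alpha>] \<open>\<mu> \<noteq> 0\<close> \<open>p < 0\<close>
        by (simp add: g'_def fX \<mu>_def power_divide)
      ultimately show "(\<lambda>n. real n * cvariance M (pow_mean p \<alpha> X n)) \<longlonglongrightarrow> cvariance M fX
            / (cmod (pow_gen_deriv p \<alpha> (pow_gen_inv p \<alpha> (\<integral>\<omega>. fX \<omega> \<partial>M))))\<^sup>2"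
        using Lim_transform_eventually[OF _ shift] by simp
    next
      assume A: "- 1 < p \<and> \<alpha> \<in> \<real> \<and> in_Ls M 1 fX \<and> \<not> in_Ls M 2 fX"
      have i1: "integrable M (Y 1)"
        using A by (intro integrable_norm_cancel[of M "Y 1"]) (auto simp: in_Ls_def fX)
      \<comment> \<open>Values in a proper cone: the real part is comparable with the modulus.\<close>
      have inf: "\<not> integrable M (\<lambda>\<omega>. (Re (u * Y 1 \<omega>))\<^sup>2)"
      proof
        assume W: "integrable M (\<lambda>\<omega>. (Re (u * Y 1 \<omega>))\<^sup>2)"
        have "integrable M (\<lambda>\<omega>. (cmod (Y 1 \<omega>))\<^sup>2)"
        proof (rule Bochner_Integration.integrable_bound)
          show "integrable M (\<lambda>\<omega>. (Re (u * Y 1 \<omega>))\<^sup>2 / \<kappa>\<^sup>2)" using W by simp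
          show "AE \<omega> in M. norm ((cmod (Y 1 \<omega>))\<^sup>2) \<le> norm ((Re (u * Y 1 \<omega>))\<^sup>2 / \<kappa>\<^sup>2)"
            using low
          proof eventually_elim
            case (elim \<omega>)
            then have "\<kappa> * cmod (Y 1 \<omega>) \<le> Re (u * Y 1 \<omega>)"
              using a(2) A by (simp add: Y_def cmod_pow_gen del: times_complex.sel)
            then have "(\<kappa> * cmod (Y 1 \<omega>))\<^sup>2 \<le> (Re (u * Y 1 \<omega>))\<^sup>2"
              using \<kappa> by (intro power_mono) auto
            then show ?case using \<kappa> by (simp add: power_mult_distrib divide_simps mult.commute del: times_complex.sel)
          qed
        qed measurable
        then show False using A i1 by (simp add: in_Ls_def fX)
      qed
      have out: "\<mu> \<in> - \<real>\<^sub>\<le>\<^sub>0" using \<mu>_out[OF i1] by simp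
      have "open (- \<real>\<^sub>\<le>\<^sub>0 :: complex set)" by (simp add: open_Compl)
      then obtain d0 where d0: "d0 > 0" "ball \<mu> d0 \<subseteq> - \<real>\<^sub>\<le>\<^sub>0"
        using out openE by blast
      have "filterlim (\<lambda>n. real n * cvariance M (\<lambda>\<omega>. g (sample_mean Y n \<omega>))) at_top sequentially"
      proof (rule Y.infinite_variance_delta_method[OF i1 u(1) inf _ ev d0(1), folded \<mu>_def])
        show "(g has_field_derivative g' w) (at w)" if "w \<in> ball \<mu> d0" for w
          using Dg d0(2) that by blast
        have "((\<lambda>w. w powr (complex_of_real (1 / p) - 1)) has_field_derivative
            (complex_of_real (1 / p) - 1) * \<mu> powr (complex_of_real (1 / p) - 1 - 1)) (at \<mu>)"
          using out by (intro has_field_derivative_powr) simp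
        then show "isCont g' \<mu>"
          unfolding g'_def[abs_def] by (intro continuous_intros DERIV_isCont)
        show "g' \<mu> \<noteq> 0" using out \<open>p < 0\<close> by (auto simp: g'_def powr_def)
      qed measurable
      then show "filterlim (\<lambda>n. real n * cvariance M (pow_mean p \<alpha> X n)) at_top sequentially"
        using filterlim_cong[OF refl refl shift] by simp
    qed
  next
    case False
    then show ?thesis using assms by simp
  qed
qed

end
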